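(* Among all hyp-hor packings $\mathcal{P}_a(y_1,y_2)$ of the hyperbolic plane generated by the simple frustum orthoschemes $\mathcal{F}_a$ with Schläfli symbol $[\infty]$, $0<a<1$, the densest configurations are provided, in the limit $a\to0$, by the packings $\mathcal{P}^1(a)$ of type 1 and $\mathcal{P}^2(a)$ of type 2, and their densities approximate $\frac3\pi$ arbitrarily accurately. That is, $$\sup_{(a,y_1,y_2)}\delta(\mathcal{P}_a(y_1,y_2))=\lim_{a\to0^+}\delta(\mathcal{P}^1(a))=\lim_{a\to0^+}\delta(\mathcal{P}^2(a))=\frac{3}{\pi},$$ where the supremum is over all admissible triples $(a,y_1,y_2)$.
   Context: The hyperbolic plane $\mathbb{H}^2$ (curvature $-1$) is represented by the Beltrami-Cayley-Klein model in the open unit disc; points are given by Cartesian coordinates in $\mathbb{R}^2$. For $0<a<1$ let $\mathcal{F}_a$ be the Lambert quadrilateral $A_0A_1P_1P_0$ with $A_0=(0,1)$ (an ideal vertex, on the unit circle), $A_1=(0,0)$, $P_1=(a,0)$, $P_0=(a,1-a^2)$. It has right angles at $A_1,P_1,P_0$, angle $0$ at $A_0$, and hyperbolic area $\pi/2$. It is the simple frustum orthoscheme with Schläfli symbol $[\infty]$ and parameter $a$; its images under reflections in its sides tile $\mathbb{H}^2$. For $0\le y_1<1$ let $\mathfrak{H}_a(y_1)$ be the closed horodisc centred at $A_0$ whose boundary horocycle passes through $(0,y_1)$. For $0\le y_2<1$ let $\mathcal{H}_a(y_2)$ be the hypercycle domain with base line $A_1P_1$ whose boundary hypercycle passes through $(0,y_2)$,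 i.e. the set of points on the same side of line $A_1P_1$ as $A_0$ (or on the line) at hyperbolic distance from this line at most that of $(0,y_2)$. The triple $(a,y_1,y_2)$ is admissible, and defines a hyp-hor packing $\mathcal{P}_a(y_1,y_2)$, if: (1) $\mathfrak{H}_a(y_1)$ has no common point with the relative interiors of the segments $A_1P_1$ and $P_0P_1$; (2) $\mathcal{H}_a(y_2)$ has no common point with the relative interior of the side $A_0P_0$; (3) the interiors of $\mathfrak{H}_a(y_1)$ and $\mathcal{H}_a(y_2)$ are disjoint. Its density is $$\delta(\mathcal{P}_a(y_1,y_2))=\frac{\mathrm{Area}(\mathcal{F}_a\cap(\mathfrak{H}_a(y_1)\cup\mathcal{H}_a(y_2)))}{\mathrm{Area}(\mathcal{F}_a)},$$ where $\mathrm{Area}$ is hyperbolic area. Type 1, $\mathcal{P}^1(a)$ ($0<a<1$): the hypercycle passes through $P_0$ and the horocycle touches it at the point $(0,y)$, so $y_1=y_2=y=\sqrt{1-a^2}$. Type 2, $\mathcal{P}^2(a)$ ($0<a\le\frac1{\sqrt2}$): the horocycle passes through $P_0$ and the hypercycle touches it at $(0,y)$, so $y_1=y_2=y=1-2a^2$. The number $3/\pi$ is the known universal upper bound for horocycle and hypercycle packing densities in $\mathbb{H}^2$. *)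

theory Defs
  imports "HOL-Analysis.Analysis"
begin

text \<open>The hyperbolic plane of curvature -1 in the Beltrami-Cayley-Klein model.\<close>

type_synonym point = "real \<times> real"

definition hplane :: "point set" where
  "hplane = ball 0 1"

definition hdist :: "point \<Rightarrow> point \<Rightarrow> real" where
  "hdist p q = arcosh ((1 - p \<bullet> q) / sqrt ((1 - (norm p)\<^sup>2) * (1 - (norm q)\<^sup>2)))"

definition hdist_set :: "point \<Rightarrow> point set \<Rightarrow> real" where
  "hdist_set p L = (INF q\<in>L. hdist p q)"

text \<open>The Riemannian area element of the Klein model is (1 - r^2)^(-3/2) dx dy.\<close>

definition harea_measure :: "point measure" where
  "harea_measure =
     density lborel (\<lambda>p. ennreal (indicator hplane p * (1 - (norm p)\<^sup>2) powr (-3/2)))"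

definition harea :: "point set \<Rightarrow> real" where
  "harea S = measure harea_measure S"

text \<open>The closed horodisc with ideal centre \<open>\<xi>\<close> whose boundary horocycle passes through \<open>q\<close>:
  a sublevel set of the Busemann function of \<open>\<xi>\<close> normalised to vanish at \<open>q\<close>.\<close>

definition busemann :: "point \<Rightarrow> point \<Rightarrow> point \<Rightarrow> real" where
  "busemann \<xi> q p = Lim (at \<xi> within hplane) (\<lambda>z. hdist p z - hdist q z)"

definition horodisc :: "point \<Rightarrow> point \<Rightarrow> point set" where
  "horodisc \<xi> q = {p \<in> hplane. busemann \<xi> q p \<le> 0}"

definition A0 :: point where "A0 = (0, 1)"
definition A1 :: point where "A1 = (0, 0)"
definition P1 :: "real \<Rightarrow> point" where "P1 a = (a, 0)"
definition P0 :: "real \<Rightarrow> point" where "P0 a = (a, 1 - a\<^sup>2)"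

text \<open>The ideal vertex \<open>A0\<close> belongs to this convex hull, but is a null set of the area measure.\<close>

definition frustum :: "real \<Rightarrow> point set" where
  "frustum a = convex hull {A0, A1, P1 a, P0 a}"

definition base_line :: "real \<Rightarrow> point set" where
  "base_line a = affine hull {A1, P1 a} \<inter> hplane"

definition frustum_horodisc :: "real \<Rightarrow> point set" where
  "frustum_horodisc y1 = horodisc A0 (0, y1)"

text \<open>The base line lies on the x-axis, and \<open>A0\<close> lies above it.\<close>

definition hypercycle_domain :: "real \<Rightarrow> real \<Rightarrow> point set" where
  "hypercycle_domain a y2 =
     {p \<in> hplane. 0 \<le> snd p \<and> hdist_set p (base_line a) \<le> hdist_set (0, y2) (base_line a)}"

definition hyp_hor_packings :: "(real \<times> real \<times> real) set" where
  "hyp_hor_packings = {(a, y1, y2).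
     0 < a \<and> a < 1 \<and> 0 \<le> y1 \<and> y1 < 1 \<and> 0 \<le> y2 \<and> y2 < 1 \<and>
     frustum_horodisc y1 \<inter> open_segment A1 (P1 a) = {} \<and>
     frustum_horodisc y1 \<inter> open_segment (P0 a) (P1 a) = {} \<and>
     hypercycle_domain a y2 \<inter> open_segment A0 (P0 a) = {} \<and>
     interior (frustum_horodisc y1) \<inter> interior (hypercycle_domain a y2) = {}}"

definition packing_density :: "real \<times> real \<times> real \<Rightarrow> real" where
  "packing_density = (\<lambda>(a, y1, y2).
     harea (frustum a \<inter> (frustum_horodisc y1 \<union> hypercycle_domain a y2)) / harea (frustum a))"

text \<open>Type 1: the hypercycle passes through \<open>P0 a\<close> and the horocycle touches it at \<open>(0, y)\<close>.
  Type 2: the horocycle passes through \<open>P0 a\<close> and the hypercycle touches it at \<open>(0, y)\<close>;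
  it is meant for \<open>a \<le> 1 / sqrt 2\<close>, so that \<open>y \<ge> 0\<close>. The lemmas \<open>P0_on_hypercycle_iff\<close> and
  \<open>P0_on_horocycle_iff\<close> below show where these values of \<open>y\<close> come from.\<close>

definition type1 :: "real \<Rightarrow> real \<times> real \<times> real" where
  "type1 a = (a, sqrt (1 - a\<^sup>2), sqrt (1 - a\<^sup>2))"

definition type2 :: "real \<Rightarrow> real \<times> real \<times> real" where
  "type2 a = (a, 1 - 2 * a\<^sup>2, 1 - 2 * a\<^sup>2)"

lemma hplane_iff: "p \<in> hplane \<longleftrightarrow> (norm p)\<^sup>2 < 1"
  by (simp add: hplane_def power_less_one_iff abs_square_less_1)

lemma norm_pair_sq: "(norm (x, y))\<^sup>2 = x\<^sup>2 + (y::real)\<^sup>2" for x :: real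
  by (simp add: norm_Pair)

lemma inner_less_one:
  assumes "p \<in> hplane" "norm z \<le> 1"
  shows "p \<bullet> z < 1"
proof -
  have "p \<bullet> z \<le> norm p * norm z"
    by (rule norm_cauchy_schwarz)
  also have "\<dots> \<le> norm p"
    using assms(2) by (simp add: mult_left_le)
  also have "\<dots> < 1"
    using assms(1) by (simp add: hplane_def)
  finally show ?thesis .
qed

lemma hdist_asymp:
  assumes p: "p \<in> hplane" and xi: "norm \<xi> = 1"
  shows "((\<lambda>z. hdist p z + ln (sqrt (1 - (norm z)\<^sup>2))) \<longlongrightarrow>
           ln (2 * ((1 - p \<bullet> \<xi>) / sqrt (1 - (norm p)\<^sup>2)))) (at \<xi> within hplane)"
proof -
  define N where "N = (\<lambda>z. (1 - p \<bullet> z) / sqrt (1 - (norm p)\<^sup>2))"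
  define s where "s = (\<lambda>z::point. sqrt (1 - (norm z)\<^sup>2))"
  have sp: "0 < 1 - (norm p)\<^sup>2"
    using p by (simp add: hplane_iff)
  have N0: "N \<xi> > 0"
    using inner_less_one[OF p, of \<xi>] xi sp by (simp add: N_def)
  have Nlim: "(N \<longlongrightarrow> N \<xi>) (at \<xi> within hplane)"
    unfolding N_def by (intro tendsto_intros) (use sp in auto)
  have slim: "(s \<longlongrightarrow> 0) (at \<xi> within hplane)"
  proof -
    have "(s \<longlongrightarrow> sqrt (1 - (norm \<xi>)\<^sup>2)) (at \<xi> within hplane)"
      unfolding s_def by (intro tendsto_intros)
    then show ?thesis using xi by simp
  qed
  have lim: "((\<lambda>z. ln (N z + sqrt ((N z)\<^sup>2 - (s z)\<^sup>2))) \<longlongrightarrow> ln (N \<xi> + sqrt ((N \<xi>)\<^sup>2 - 0\<^sup>2)))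
      (at \<xi> within hplane)"
    by (intro tendsto_intros Nlim slim) (use N0 in auto)
  have ev: "\<forall>\<^sub>F z in at \<xi> within hplane.
      ln (N z + sqrt ((N z)\<^sup>2 - (s z)\<^sup>2)) = hdist p z + ln (s z)"
  proof -
    have "((\<lambda>z. N z - s z) \<longlongrightarrow> N \<xi> - 0) (at \<xi> within hplane)"
      by (intro tendsto_intros Nlim slim)
    then have e1: "\<forall>\<^sub>F z in at \<xi> within hplane. N z - s z > 0"
      by (rule order_tendstoD) (use N0 in simp)
    have e2: "\<forall>\<^sub>F z in at \<xi> within hplane. z \<in> hplane"
      by (simp add: eventually_at_filter)
    show ?thesis
      using e1 e2
    proof eventually_elim
      case (elim z)
      have s0: "s z > 0"
        using elim(2) by (simp add: s_def hplane_iff)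
      have Nz: "N z > 0" "N z / s z \<ge> 1"
        using elim(1) s0 by (auto simp: field_simps)
      have hd: "hdist p z = arcosh (N z / s z)"
        by (simp add: hdist_def N_def s_def real_sqrt_mult)
      have sq: "(N z)\<^sup>2 - (s z)\<^sup>2 \<ge> 0"
        using elim(1) s0 by (simp add: power_mono)
      have "(N z / s z)\<^sup>2 - 1 = ((N z)\<^sup>2 - (s z)\<^sup>2) / (s z)\<^sup>2"
        using s0 by (simp add: field_simps)
      then have "sqrt ((N z / s z)\<^sup>2 - 1) = sqrt ((N z)\<^sup>2 - (s z)\<^sup>2) / s z"
        using s0 by (simp add: real_sqrt_divide)
      then have "hdist p z = ln ((N z + sqrt ((N z)\<^sup>2 - (s z)\<^sup>2)) / s z)"
        unfolding hd by (subst arcosh_real_def[OF Nz(2)]) (simp add: add_divide_distrib)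
      also have "\<dots> = ln (N z + sqrt ((N z)\<^sup>2 - (s z)\<^sup>2)) - ln (s z)"
        using Nz(1) sq s0 by (subst ln_div) (auto simp: add_pos_nonneg add_nonneg_eq_0_iff)
      finally show ?case by simp
    qed
  qed
  have "((\<lambda>z. hdist p z + ln (s z)) \<longlongrightarrow> ln (N \<xi> + sqrt ((N \<xi>)\<^sup>2 - 0\<^sup>2))) (at \<xi> within hplane)"
    by (rule Lim_transform_eventually[OF lim ev])
  moreover have "N \<xi> + sqrt ((N \<xi>)\<^sup>2 - 0\<^sup>2) = 2 * N \<xi>"
    using N0 by simp
  ultimately show ?thesis
    by (simp only: N_def s_def)
qed

lemma busemann_eq:
  assumes p: "p \<in> hplane" and q: "q \<in> hplane" and xi: "norm \<xi> = 1"
  shows "busemann \<xi> q p = ln ((1 - p \<bullet> \<xi>) / sqrt (1 - (norm p)\<^sup>2))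
                        - ln ((1 - q \<bullet> \<xi>) / sqrt (1 - (norm q)\<^sup>2))"
proof -
  have pos: "(1 - r \<bullet> \<xi>) / sqrt (1 - (norm r)\<^sup>2) > 0" if "r \<in> hplane" for r
    using inner_less_one[OF that, of \<xi>] xi that by (simp add: hplane_iff)
  have nt: "\<not> trivial_limit (at \<xi> within hplane)"
    using xi by (simp add: hplane_def trivial_limit_within islimpt_ball)
  have "((\<lambda>z. hdist p z - hdist q z) \<longlongrightarrow>
          ln (2 * ((1 - p \<bullet> \<xi>) / sqrt (1 - (norm p)\<^sup>2)))
          - ln (2 * ((1 - q \<bullet> \<xi>) / sqrt (1 - (norm q)\<^sup>2)))) (at \<xi> within hplane)"
    using tendsto_diff[OF hdist_asymp[OF p xi] hdist_asymp[OF q xi]] by simp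
  then have "busemann \<xi> q p = ln (2 * ((1 - p \<bullet> \<xi>) / sqrt (1 - (norm p)\<^sup>2)))
          - ln (2 * ((1 - q \<bullet> \<xi>) / sqrt (1 - (norm q)\<^sup>2)))"
    unfolding busemann_def by (rule tendsto_Lim[OF nt])
  also have "\<dots> = ln ((1 - p \<bullet> \<xi>) / sqrt (1 - (norm p)\<^sup>2))
                 - ln ((1 - q \<bullet> \<xi>) / sqrt (1 - (norm q)\<^sup>2))"
    by (subst (1 2) ln_mult_pos) (use pos[OF p] pos[OF q] in auto)
  finally show ?thesis .
qed

lemma mem_frustum_horodisc_iff:
  assumes "0 \<le> s" "s < 1"
  shows "(x, y) \<in> frustum_horodisc s \<longleftrightarrow>
           x\<^sup>2 + y\<^sup>2 < 1 \<and> (1 - y) / sqrt (1 - (x\<^sup>2 + y\<^sup>2)) \<le> (1 - s) / sqrt (1 - s\<^sup>2)"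
proof -
  have s2: "s\<^sup>2 < 1"
    using assms by (simp add: abs_square_less_1)
  have q: "(0, s) \<in> hplane"
    using s2 by (simp add: hplane_iff norm_pair_sq)
  have pos: "(1 - s) / sqrt (1 - s\<^sup>2) > 0"
    using assms s2 by simp
  show ?thesis
  proof (cases "(x, y) \<in> hplane")
    case True
    then have h: "x\<^sup>2 + y\<^sup>2 < 1"
      by (simp add: hplane_iff norm_pair_sq)
    then have "y\<^sup>2 < 1"
      by (smt (verit) zero_le_power2)
    then have "y < 1"
      by (simp add: abs_square_less_1)
    with h have "(1 - y) / sqrt (1 - (x\<^sup>2 + y\<^sup>2)) > 0"
      by simp
    with pos True h show ?thesis
      by (simp add: frustum_horodisc_def horodisc_def busemann_eq q A0_def norm_pair_sq)
  next
    case False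
    then show ?thesis
      by (simp add: frustum_horodisc_def horodisc_def hplane_iff norm_pair_sq)
  qed
qed

lemma base_line_eq:
  assumes "a \<noteq> 0"
  shows "base_line a = {(t, 0) | t. t\<^sup>2 < 1}"
proof -
  have "affine hull {A1, P1 a} = {(t, 0) | t. True}"
  proof (intro set_eqI iffI)
    fix p assume "p \<in> affine hull {A1, P1 a}"
    then show "p \<in> {(t, 0) | t. True}"
      by (auto simp: affine_hull_2 A1_def P1_def)
  next
    fix p :: point assume "p \<in> {(t, 0) | t. True}"
    then obtain t where "p = (t, 0)" by auto
    then have "p = (1 - t / a) *\<^sub>R A1 + (t / a) *\<^sub>R P1 a"
      using assms by (simp add: A1_def P1_def)
    then show "p \<in> affine hull {A1, P1 a}"
      unfolding affine_hull_2 by (smt (verit) mem_Collect_eq)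
  qed
  then show ?thesis
    by (auto simp: base_line_def hplane_iff norm_pair_sq)
qed

lemma hdist_set_base_line:
  assumes "a \<noteq> 0" and h: "x\<^sup>2 + y\<^sup>2 < 1"
  shows "hdist_set (x, y) (base_line a) = arcosh (sqrt (1 - x\<^sup>2) / sqrt (1 - (x\<^sup>2 + y\<^sup>2)))"
proof -
  define c where "c = sqrt (1 - (x\<^sup>2 + y\<^sup>2))"
  have x1: "x\<^sup>2 < 1"
    using h by (smt (verit) zero_le_power2)
  have c0: "c > 0"
    using h by (simp add: c_def)
  have base: "sqrt (1 - x\<^sup>2) / c \<ge> 1"
    using h x1 by (simp add: c_def)
  have hd: "hdist (x, y) (t, 0) = arcosh ((1 - x * t) / (c * sqrt (1 - t\<^sup>2)))" for t
    by (simp add: hdist_def norm_pair_sq c_def real_sqrt_mult)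
  have ge: "arcosh (sqrt (1 - x\<^sup>2) / c) \<le> hdist (x, y) (t, 0)" if t: "t\<^sup>2 < 1" for t
  proof -
    have "x * t \<le> (x\<^sup>2 + t\<^sup>2) / 2"
      using sum_squares_bound[of x t] by simp
    then have xt: "x * t < 1"
      using x1 t by simp
    have "(1 - x\<^sup>2) * (1 - t\<^sup>2) \<le> (1 - x * t)\<^sup>2"
      using zero_le_power2[of "x - t"] by (simp add: power2_eq_square algebra_simps)
    then have "sqrt (1 - x\<^sup>2) * sqrt (1 - t\<^sup>2) \<le> 1 - x * t"
      using xt by (simp flip: real_sqrt_mult add: real_le_lsqrt)
    then have "sqrt (1 - x\<^sup>2) / c \<le> (1 - x * t) / (c * sqrt (1 - t\<^sup>2))"
      using c0 t by (simp add: field_simps)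
    with base show ?thesis
      unfolding hd by (metis arcosh_less_iff_real linorder_not_le order_trans)
  qed
  have eq: "hdist (x, y) (x, 0) = arcosh (sqrt (1 - x\<^sup>2) / c)"
  proof -
    have "(1 - x * x) / (c * sqrt (1 - x\<^sup>2)) = sqrt (1 - x\<^sup>2) / c"
      using x1 c0 by (simp add: field_simps power2_eq_square)
    then show ?thesis by (simp add: hd)
  qed
  have "hdist_set (x, y) (base_line a) = arcosh (sqrt (1 - x\<^sup>2) / c)"
    unfolding hdist_set_def
  proof (rule cInf_eq_minimum)
    show "arcosh (sqrt (1 - x\<^sup>2) / c) \<in> hdist (x, y) ` base_line a"
      using eq x1 by (auto simp: base_line_eq[OF assms(1)] image_iff)
  next
    fix d assume "d \<in> hdist (x, y) ` base_line a"
    then show "arcosh (sqrt (1 - x\<^sup>2) / c) \<le> d"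
      using ge by (auto simp: base_line_eq[OF assms(1)])
  qed
  then show ?thesis by (simp add: c_def)
qed

lemma hdist_set_base_line_le_iff:
  assumes "a \<noteq> 0" "x\<^sup>2 + y\<^sup>2 < 1" "0 \<le> s" "s < 1"
  shows "hdist_set (x, y) (base_line a) \<le> hdist_set (0, s) (base_line a)
           \<longleftrightarrow> y\<^sup>2 \<le> s\<^sup>2 * (1 - x\<^sup>2)" (is ?le)
    and "hdist_set (x, y) (base_line a) = hdist_set (0, s) (base_line a)
           \<longleftrightarrow> y\<^sup>2 = s\<^sup>2 * (1 - x\<^sup>2)" (is ?eq)
proof -
  have s2: "s\<^sup>2 < 1"
    using assms by (simp add: abs_square_less_1)
  have x1: "x\<^sup>2 < 1"
    using assms(2) by (smt (verit) zero_le_power2)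
  define A where "A = (1 - x\<^sup>2) / (1 - (x\<^sup>2 + y\<^sup>2))"
  define B where "B = 1 / (1 - s\<^sup>2)"
  have A1: "A \<ge> 1" and B1: "B \<ge> 1"
    using assms(2) s2 by (auto simp: A_def B_def)
  have d: "hdist_set (x, y) (base_line a) = arcosh (sqrt A)"
          "hdist_set (0, s) (base_line a) = arcosh (sqrt B)"
    using hdist_set_base_line[OF assms(1,2)] hdist_set_base_line[OF assms(1), of 0 s] s2
    by (auto simp: A_def B_def real_sqrt_divide)
  have lt: "arcosh (sqrt u) < arcosh (sqrt v) \<longleftrightarrow> u < v" if "u \<ge> 1" "v \<ge> 1" for u v :: real
    using that by simp
  have AB: "A \<le> B \<longleftrightarrow> y\<^sup>2 \<le> s\<^sup>2 * (1 - x\<^sup>2)" "A = B \<longleftrightarrow> y\<^sup>2 = s\<^sup>2 * (1 - x\<^sup>2)"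
    using assms(2) s2 by (auto simp: A_def B_def field_simps)
  show ?le
    using lt[OF B1 A1] AB by (simp add: d linorder_not_less[symmetric])
  show ?eq
    using lt[OF B1 A1] lt[OF A1 B1] AB by (smt (verit) d)
qed

lemma mem_hypercycle_domain_iff:
  assumes "a \<noteq> 0" "0 \<le> s" "s < 1"
  shows "(x, y) \<in> hypercycle_domain a s \<longleftrightarrow>
           x\<^sup>2 + y\<^sup>2 < 1 \<and> 0 \<le> y \<and> y\<^sup>2 \<le> s\<^sup>2 * (1 - x\<^sup>2)"
  using hdist_set_base_line_le_iff(1)[OF assms(1) _ assms(2,3)]
  by (auto simp: hypercycle_domain_def hplane_iff norm_pair_sq)

lemma P0_in_hplane:
  fixes a :: real
  assumes "0 < a" "a < 1"
  shows "a\<^sup>2 + (1 - a\<^sup>2)\<^sup>2 < 1"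
proof -
  have "a\<^sup>2 < 1"
    using assms by (simp add: power_less_one_iff)
  then have "a\<^sup>2 * a\<^sup>2 < a\<^sup>2 * 1"
    using assms by (intro mult_strict_left_mono) auto
  then show ?thesis by (simp add: power2_eq_square algebra_simps)
qed

lemma P0_on_hypercycle_iff:
  assumes "0 < a" "a < 1" "0 \<le> y" "y < 1"
  shows "hdist_set (P0 a) (base_line a) = hdist_set (0, y) (base_line a) \<longleftrightarrow> y = sqrt (1 - a\<^sup>2)"
proof -
  have a2: "a\<^sup>2 < 1"
    using assms by (simp add: abs_square_less_1)
  have "hdist_set (P0 a) (base_line a) = hdist_set (0, y) (base_line a)
      \<longleftrightarrow> (1 - a\<^sup>2)\<^sup>2 = y\<^sup>2 * (1 - a\<^sup>2)"
    unfolding P0_def using assms P0_in_hplane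
    by (intro hdist_set_base_line_le_iff(2)) auto
  also have "\<dots> \<longleftrightarrow> y\<^sup>2 = 1 - a\<^sup>2"
    using a2 by (auto simp: power2_eq_square)
  also have "\<dots> \<longleftrightarrow> y = sqrt (1 - a\<^sup>2)"
    using assms(3) a2 by (auto simp: real_sqrt_unique)
  finally show ?thesis .
qed

lemma P0_on_horocycle_iff:
  assumes "0 < a" "a < 1" "0 \<le> y" "y < 1"
  shows "busemann A0 (0, y) (P0 a) = 0 \<longleftrightarrow> y = 1 - 2 * a\<^sup>2"
proof -
  have a2: "0 < a\<^sup>2" "a\<^sup>2 < 1" and y2: "y\<^sup>2 < 1"
    using assms by (simp_all add: abs_square_less_1)
  define u where "u = a\<^sup>2 / sqrt (1 - (a\<^sup>2 + (1 - a\<^sup>2)\<^sup>2))"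
  define v where "v = (1 - y) / sqrt (1 - y\<^sup>2)"
  have u0: "u > 0" and v0: "v > 0"
    using a2 y2 assms P0_in_hplane[of a] by (auto simp: u_def v_def)
  have h: "P0 a \<in> hplane" "(0, y) \<in> hplane"
    using P0_in_hplane[OF assms(1,2)] y2 by (auto simp: P0_def hplane_iff norm_pair_sq)
  have b: "busemann A0 (0, y) (P0 a) = ln u - ln v"
    using busemann_eq[OF h, of A0] by (simp add: A0_def P0_def norm_pair_sq u_def v_def)
  have d: "1 - (a\<^sup>2 + (1 - a\<^sup>2)\<^sup>2) = a\<^sup>2 * (1 - a\<^sup>2)"
    by (simp add: power2_eq_square algebra_simps)
  have uu: "u\<^sup>2 = a\<^sup>2 / (1 - a\<^sup>2)"
    unfolding u_def d using a2 by (simp add: power_divide power2_eq_square)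
  have "v\<^sup>2 = (1 - y)\<^sup>2 / (1 - y\<^sup>2)"
    unfolding v_def using y2 by (simp add: power_divide)
  also have "1 - y\<^sup>2 = (1 - y) * (1 + y)"
    by (simp add: power2_eq_square algebra_simps)
  finally have vv: "v\<^sup>2 = (1 - y) / (1 + y)"
    using assms by (simp add: power2_eq_square)
  have "ln u - ln v = 0 \<longleftrightarrow> u\<^sup>2 = v\<^sup>2"
    using u0 v0 by (simp add: power2_eq_iff_nonneg)
  also have "\<dots> \<longleftrightarrow> y = 1 - 2 * a\<^sup>2"
    unfolding uu vv using a2 assms by (simp add: field_simps)
  finally show ?thesis by (simp add: b)
qed

end

theory Submission
  imports Defs
begin

text \<open>
Everything is computed in one frustum. Put \<open>c = \<surd>(1 - a\<^sup>2)\<close> and let a point \<open>(0, s)\<close> of the side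
\<open>A0 A1\<close> be described by \<open>k = \<surd>((1 - s) / (1 + s))\<close>, which is \<open>exp (- d)\<close> for its distance \<open>d\<close> from
\<open>A1\<close>.

Three areas are needed. Cutting by vertical lines gives \<open>\<pi> / 2\<close> for the frustum
(\<open>emeasure_harea_frustum\<close>) and \<open>s / \<surd>(1 - s\<^sup>2) * artanh a\<close> for the part under the hypercycle
(\<open>emeasure_harea_hypercycle_strip\<close>). Cutting by the rays from the ideal vertex gives \<open>k / a\<close> for the
horodisc part, because each ray contributes \<open>k\<close> (\<open>emeasure_harea_horodisc_sector\<close>).

The tangencies at \<open>P0\<close> and on the side \<open>A0 A1\<close> turn the three conditions of a packing into
inequalities: the triple \<open>(a, s1, s2)\<close> is admissible iff \<open>s2 \<le> s1\<close>, \<open>1 - 2 a\<^sup>2 \<le> s1\<close> and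
\<open>s2\<^sup>2 \<le> 1 - a\<^sup>2\<close> (\<open>hyp_hor_packings_iff\<close>). The two parts then overlap at most in a null set, so the
density is the sum of their areas over \<open>\<pi> / 2\<close> (\<open>packing_density_eq\<close>).

For the upper bound the two parts may be enlarged until they touch. The covered area of a touching
pair is \<open>k / a + (1 / k - k) / 2 * artanh a\<close>, a convex function of \<open>k\<close>. It is therefore largest at the
ends of the admissible range (\<open>contact_area_le\<close>). These are type 1 and type 2, where the estimate
\<open>artanh a \<le> a / (2 c) + a / (1 + c)\<close> bounds it by \<open>3 / 2\<close>; for \<open>a > 1 / \<surd>2\<close> the end \<open>k = 1\<close> takes the
place of type 2, and there the area is only \<open>1 / a\<close>. So the density is at most
\<open>(3 / 2) / (\<pi> / 2) = 3 / \<pi>\<close>. Finally, the covered areas of the two types are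
\<open>1 / (1 + c) + c * (artanh a / a)\<close> and \<open>1 / c + (1 - 2 a\<^sup>2) / (2 c) * (artanh a / a)\<close>, and both tend
to \<open>3 / 2\<close> as \<open>a\<close> tends to \<open>0\<close> because \<open>artanh a / a\<close> tends to \<open>1\<close>.
\<close>

section \<open>The covered area of touching configurations\<close>

lemma inverse_le_chord:
  fixes p k q :: real
  assumes "0 < p" "p \<le> k" "k \<le> q"
  shows "1 / k \<le> (p + q - k) / (p * q)"
proof -
  have "(k - p) * (q - k) \<ge> 0"
    using assms by simp
  then show ?thesis
    using assms by (simp add: field_simps)
qed

text \<open>For \<open>B \<ge> 0\<close> the function \<open>k \<mapsto> A k + B / k\<close> is convex on the positive reals, whatever the
sign of \<open>A\<close>, so on an interval it is largest at an endpoint.\<close>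

lemma add_inverse_le_max_endpoints:
  fixes A B p k q M :: real
  assumes "0 \<le> B" "0 < p" "p \<le> k" "k \<le> q"
    and "A * p + B / p \<le> M" "A * q + B / q \<le> M"
  shows "A * k + B / k \<le> M"
proof (cases "p = q")
  case True
  then show ?thesis using assms by simp
next
  case False
  define t where "t = (k - p) / (q - p)"
  have t: "0 \<le> t" "t \<le> 1"
    using assms False by (auto simp: t_def)
  have "t * (q - p) = k - p"
    using False by (simp add: t_def)
  then have k: "k = (1 - t) * p + t * q"
    by (simp add: algebra_simps)
  have "B * (1 / k) \<le> B * ((p + q - k) / (p * q))"
    using assms by (intro mult_left_mono inverse_le_chord) auto
  also have "(p + q - k) / (p * q) = (1 - t) / p + t / q"
    using assms by (simp add: k field_simps)
  finally have "A * k + B / k \<le> (1 - t) * (A * p + B / p) + t * (A * q + B / q)"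
    by (simp add: k algebra_simps add_divide_distrib diff_divide_distrib)
  also have "\<dots> \<le> (1 - t) * M + t * M"
    using t assms by (intro add_mono mult_left_mono) auto
  finally show ?thesis by (simp add: algebra_simps)
qed

text \<open>This is the whole analytic content of the density bound: it is equivalent to the statement that
the packing of type 1 covers area at most \<open>3 / 2\<close>. With \<open>w = \<surd>(1 - x\<^sup>2)\<close> the difference of the
two sides has derivative \<open>(1 - w) / (2 w\<^sup>3 (1 + w)) \<ge> 0\<close>, and it vanishes at \<open>0\<close>.\<close>

lemma artanh_upper_bound:
  fixes a :: real
  assumes "0 \<le> a" "a < 1"
  defines "c \<equiv> sqrt (1 - a\<^sup>2)"
  shows "artanh a \<le> a / (2 * c) + a / (1 + c)"
proof -
  define R where
    "R = (\<lambda>x. x / (2 * sqrt (1 - x\<^sup>2)) + x / (1 + sqrt (1 - x\<^sup>2)) - artanh x)"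
  have "R 0 \<le> R a"
  proof (rule DERIV_nonneg_imp_nondecreasing[OF assms(1)])
    fix x assume x: "0 \<le> x" "x \<le> a"
    define w where "w = sqrt (1 - x\<^sup>2)"
    have x2: "x\<^sup>2 < 1"
      using x assms(2) by (simp add: abs_square_less_1)
    have w: "0 < w" "w \<le> 1" "x\<^sup>2 = 1 - w\<^sup>2"
      using x2 by (auto simp: w_def)
    have dw: "((\<lambda>x. sqrt (1 - x\<^sup>2)) has_real_derivative - x / w) (at x)"
      unfolding w_def
      by (rule derivative_eq_intros refl | use x2 in \<open>simp add: field_simps; fail\<close>)+
    from DERIV_divide[OF DERIV_ident DERIV_cmult[OF dw, of 2], folded w_def] w(1)
    have d1: "((\<lambda>x. x / (2 * sqrt (1 - x\<^sup>2))) has_real_derivative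
        (1 * (2 * w) - x * (2 * (- x / w))) / (2 * w * (2 * w))) (at x)"
      by simp
    from DERIV_divide[OF DERIV_ident DERIV_add[OF DERIV_const dw], of 1, folded w_def] w(1)
    have d2: "((\<lambda>x. x / (1 + sqrt (1 - x\<^sup>2))) has_real_derivative
        (1 * (1 + w) - x * (0 + - x / w)) / ((1 + w) * (1 + w))) (at x)"
      by simp
    have e1: "(1 * (2 * w) - x * (2 * (- x / w))) / (2 * w * (2 * w)) = 1 / (2 * w ^ 3)"
    proof -
      have "1 * (2 * w) - x * (2 * (- x / w)) = 2 * (w\<^sup>2 + x\<^sup>2) / w"
        using w(1) by (simp add: field_simps power2_eq_square)
      also have "\<dots> = 2 / w"
        by (simp add: w(3))
      finally show ?thesis
        using w(1) by (simp add: field_simps power3_eq_cube)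
    qed
    have e2: "(1 * (1 + w) - x * (0 + - x / w)) / ((1 + w) * (1 + w)) = 1 / (w * (1 + w))"
    proof -
      have "1 * (1 + w) - x * (0 + - x / w) = (w + w\<^sup>2 + x\<^sup>2) / w"
        using w(1) by (simp add: field_simps power2_eq_square)
      also have "\<dots> = (1 + w) / w"
        by (simp add: w(3))
      finally show ?thesis
        using w(1) by simp
    qed
    have "(R has_real_derivative 1 / (2 * w ^ 3) + 1 / (w * (1 + w)) - 1 / (1 - x\<^sup>2)) (at x)"
      unfolding R_def
      by (intro DERIV_diff DERIV_add d1[unfolded e1] d2[unfolded e2] artanh_real_has_field_derivative)
        (use x assms(2) in auto)
    moreover have "1 / (2 * w ^ 3) + 1 / (w * (1 + w)) - 1 / (1 - x\<^sup>2) = (1 - w) / (2 * w ^ 3 * (1 + w))"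
      using w(1) by (simp add: w(3) divide_simps) (simp add: algebra_simps power2_eq_square power3_eq_cube)
    moreover have "0 \<le> (1 - w) / (2 * w ^ 3 * (1 + w))"
      using w by simp
    ultimately show "\<exists>y. (R has_real_derivative y) (at x) \<and> 0 \<le> y"
      by metis
  qed
  then show ?thesis
    by (simp add: R_def c_def)
qed

text \<open>The expression \<open>k / a + (1 / k - k) / 2 * artanh a\<close> is the area covered when horocycle and hypercycle
touch on the side \<open>A0 A1\<close>, written in the parameter \<open>k = exp (- d)\<close>, where \<open>d\<close> is the hyperbolic
distance of the contact point from \<open>A1\<close>. For type 1, with \<open>c = \<surd>(1 - a\<^sup>2)\<close>, the parameter is
\<open>(1 - c) / a\<close> and the area simplifies to \<open>1 / (1 + c) + (c / a) * artanh a\<close>.\<close>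

lemma contact_area_type1_le:
  fixes a :: real
  assumes a: "0 < a" "a < 1"
  defines "p \<equiv> (1 - sqrt (1 - a\<^sup>2)) / a"
  shows "p / a + (1 / p - p) / 2 * artanh a \<le> 3 / 2"
proof -
  define c where "c = sqrt (1 - a\<^sup>2)"
  define L where "L = artanh a"
  have "a\<^sup>2 < 1"
    using a by (simp add: abs_square_less_1)
  moreover have "0 < a\<^sup>2"
    using a by simp
  ultimately have c: "0 < c" "c < 1" and cc: "c * c = 1 - a * a"
    by (auto simp: c_def power2_eq_square)
  have L: "L \<le> a / (2 * c) + a / (1 + c)"
    unfolding L_def c_def by (rule artanh_upper_bound) (use a in auto)
  have p_eq: "p = (1 - c) / a"
    by (simp add: p_def c_def)
  have aa: "a * a = (1 - c) * (1 + c)"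
    using cc by (simp add: algebra_simps)
  have "p / a = 1 / (1 + c)"
    using a c by (simp add: p_eq aa)
  moreover have "1 / p = (1 + c) / a"
    using a c aa by (simp add: p_eq frac_eq_eq)
  moreover have "(1 + c) / a - (1 - c) / a = 2 * (c / a)"
    by (simp add: diff_divide_distrib add_divide_distrib)
  ultimately have "p / a + (1 / p - p) / 2 * L = 1 / (1 + c) + c / a * L"
    by (simp add: p_eq)
  also have "\<dots> \<le> 1 / (1 + c) + c / a * (a / (2 * c) + a / (1 + c))"
    using a c L by (intro add_left_mono mult_left_mono) auto
  also have "\<dots> = 1 / (1 + c) + (1 / 2 + c / (1 + c))"
    using a(1) c(1) by (simp add: distrib_left)
  also have "\<dots> = (1 + c) / (1 + c) + 1 / 2"
    by (simp only: add_divide_distrib)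
  also have "\<dots> = 3 / 2"
    using c(1) by simp
  finally show ?thesis
    by (simp add: L_def)
qed

text \<open>For type 2 the parameter is \<open>a / c\<close> with \<open>c = \<surd>(1 - a\<^sup>2)\<close>, and the same estimate of \<open>artanh a\<close>
leaves the margin \<open>(1 - c) / (4 c\<^sup>2 (1 + c))\<close> below \<open>3 / 2\<close>.\<close>

lemma contact_area_type2_le:
  fixes a :: real
  assumes a: "0 < a" "a < 1" "a \<le> sqrt (1 - a\<^sup>2)"
  defines "q \<equiv> a / sqrt (1 - a\<^sup>2)"
  shows "q / a + (1 / q - q) / 2 * artanh a \<le> 3 / 2"
proof -
  define c where "c = sqrt (1 - a\<^sup>2)"
  define L where "L = artanh a"
  have "a\<^sup>2 < 1"
    using a by (simp add: abs_square_less_1)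
  moreover have "0 < a\<^sup>2"
    using a by simp
  ultimately have c: "0 < c" "c < 1" and cc: "c * c = 1 - a * a"
    by (auto simp: c_def power2_eq_square)
  have L: "L \<le> a / (2 * c) + a / (1 + c)"
    unfolding L_def c_def by (rule artanh_upper_bound) (use a in auto)
  have q_eq: "q = a / c"
    by (simp add: q_def c_def)
  have nn: "0 \<le> c / a - a / c"
    using a c(1) unfolding c_def[symmetric]
    by (smt (verit) divide_le_eq_1_pos le_divide_eq_1_pos)
  have "q / a + (1 / q - q) / 2 * L = 1 / c + (c / a - a / c) / 2 * L"
    using a(1) c(1) by (simp add: q_eq)
  also have "\<dots> \<le> 1 / c + (c / a - a / c) / 2 * (a / (2 * c) + a / (1 + c))"
    using L nn by (intro add_left_mono mult_left_mono) auto
  also have "(c / a - a / c) / 2 * (a / (2 * c) + a / (1 + c))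
      = (c * c - a * a) / 2 * (1 / (2 * c * c) + 1 / (c * (1 + c)))"
  proof -
    have "c / a - a / c = (c * c - a * a) / (a * c)"
      using a(1) c(1) by (simp add: field_simps)
    moreover have "a / (2 * c) + a / (1 + c) = (a * c) * (1 / (2 * c * c) + 1 / (c * (1 + c)))"
    proof -
      have "a / (2 * c) = (a * c) * (1 / (2 * c * c))" "a / (1 + c) = (a * c) * (1 / (c * (1 + c)))"
        using c(1) by simp_all
      then show ?thesis
        by (simp only: distrib_left)
    qed
    ultimately show ?thesis
      using a(1) c(1) by simp
  qed
  also have "c * c - a * a = 2 * c * c - 1"
    using cc by simp
  also have "1 / c + (2 * c * c - 1) / 2 * (1 / (2 * c * c) + 1 / (c * (1 + c)))
      = 3 / 2 - (1 - c) / (4 * (c * c) * (1 + c))"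
    using c(1) by (simp add: divide_simps) (simp add: algebra_simps)
  also have "\<dots> \<le> 3 / 2"
    using c by simp
  finally show ?thesis
    by (simp add: L_def)
qed

text \<open>The contact parameters that the side \<open>P0 P1\<close> allows fill an interval whose lower end is the
parameter of type 1. Its upper end is the parameter of type 2, or \<open>1\<close> once \<open>a\<close> is so large that type 2
does not exist; then the hypercycle domain degenerates to the base line and \<open>1 / a \<le> 3 / 2\<close> suffices.
Convexity reduces everything to these ends.\<close>

lemma contact_area_le:
  fixes a k :: real
  assumes a: "0 < a" "a < 1"
    and k: "(1 - sqrt (1 - a\<^sup>2)) / a \<le> k" "k \<le> 1" "k\<^sup>2 * (1 - a\<^sup>2) \<le> a\<^sup>2"
  shows "k / a + (1 / k - k) / 2 * artanh a \<le> 3 / 2"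
proof -
  define c where "c = sqrt (1 - a\<^sup>2)"
  define L where "L = artanh a"
  define p where "p = (1 - c) / a"
  define q where "q = min 1 (a / c)"
  have "a\<^sup>2 < 1"
    using a by (simp add: abs_square_less_1)
  moreover have "0 < a\<^sup>2"
    using a by simp
  ultimately have c: "0 < c" "c < 1" "c\<^sup>2 = 1 - a\<^sup>2"
    by (auto simp: c_def)
  have L0: "0 \<le> L"
    unfolding L_def artanh_def using a by simp
  have p: "0 < p" "p \<le> k"
    using a c(2) k(1) by (simp_all add: p_def c_def)
  have "(k * c)\<^sup>2 \<le> a\<^sup>2"
    using k(3) by (simp add: power_mult_distrib c(3))
  then have "k * c \<le> a"
    by (rule power2_le_imp_le) (use a in simp)
  then have q: "k \<le> q"
    using k(2) c(1) by (simp add: q_def field_simps)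
  have rearrange: "(1 / a - L / 2) * r + (L / 2) / r = r / a + (1 / r - r) / 2 * L" for r
    by (simp add: algebra_simps diff_divide_distrib)
  have at_p: "p / a + (1 / p - p) / 2 * L \<le> 3 / 2"
    unfolding p_def c_def L_def by (rule contact_area_type1_le[OF a])
  have at_q: "q / a + (1 / q - q) / 2 * L \<le> 3 / 2"
  proof (cases "a \<le> c")
    case True
    then have "q = a / sqrt (1 - a\<^sup>2)"
      using c(1) by (simp add: q_def c_def)
    then show ?thesis
      using contact_area_type2_le[OF a] True by (simp only: c_def L_def)
  next
    case False
    then have q_eq: "q = 1"
      using c(1) by (simp add: q_def)
    have "c\<^sup>2 < a\<^sup>2"
      using False c(1) by (intro power_strict_mono) auto
    then have "(2 / 3)\<^sup>2 \<le> a\<^sup>2"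
      unfolding c(3) by (simp add: power_divide)
    then have "2 / 3 \<le> a"
      using a(1) by (meson less_imp_le power2_le_imp_le)
    then show ?thesis
      using a(1) by (simp add: q_eq field_simps)
  qed
  have "(1 / a - L / 2) * k + (L / 2) / k \<le> 3 / 2"
    by (rule add_inverse_le_max_endpoints[of _ p _ q])
      (use L0 p q at_p at_q rearrange[of p] rearrange[of q] in linarith)+
  then show ?thesis
    by (simp only: rearrange L_def[symmetric])
qed

section \<open>Hyperbolic area by vertical slices\<close>

lemma borel_measurable_coordinates [measurable]:
  "fst \<in> borel_measurable (borel :: (real \<times> real) measure)"
  "snd \<in> borel_measurable (borel :: (real \<times> real) measure)"
  by (simp_all add: borel_measurable_continuous_onI continuous_intros)

text \<open>The integrand may be singular at the ends of the interval, as it is for the area integrals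
  below that reach the ideal vertex.\<close>

lemma nn_integral_FTC_interior:
  fixes F f :: "real \<Rightarrow> real"
  assumes "a \<le> b" "continuous_on {a..b} F"
    and "\<And>x. a < x \<Longrightarrow> x < b \<Longrightarrow> (F has_real_derivative f x) (at x)"
    and "\<And>x. a < x \<Longrightarrow> x < b \<Longrightarrow> 0 \<le> f x"
  shows "(\<integral>\<^sup>+x. ennreal (f x) * indicator {a<..<b} x \<partial>lborel) = ennreal (F b - F a)"
proof (rule nn_integral_has_integral_lebesgue')
  have "(f has_integral F b - F a) {a..b}"
    using assms by (intro fundamental_theorem_of_calculus_interior)
      (auto simp: has_real_derivative_iff_has_vector_derivative)
  then show "(f has_integral F b - F a) {a<..<b}"
    by (simp add: has_integral_Icc_iff_Ioo)
qed (use assms in auto)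

definition klein_density :: "real \<Rightarrow> real \<Rightarrow> real" where
  "klein_density x y =
     (if x\<^sup>2 + y\<^sup>2 < 1 then 1 / ((1 - (x\<^sup>2 + y\<^sup>2)) * sqrt (1 - (x\<^sup>2 + y\<^sup>2))) else 0)"

lemma powr_minus_three_halves:
  fixes u :: real
  assumes "0 < u"
  shows "u powr (- 3 / 2) = 1 / (u * sqrt u)"
proof -
  have "u powr (3 / 2) = u powr 1 * u powr (1 / 2)"
    by (simp only: powr_add[symmetric]) simp
  then show ?thesis
    using assms by (simp add: powr_minus_divide powr_half_sqrt)
qed

lemma measurable_klein_density [measurable]:
  "(\<lambda>p. klein_density (fst p) (snd p)) \<in> borel_measurable (borel \<Otimes>\<^sub>M borel)"
  unfolding klein_density_def by measurable

lemma harea_measure_eq: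
  "harea_measure = density (lborel \<Otimes>\<^sub>M lborel) (\<lambda>p. ennreal (klein_density (fst p) (snd p)))"
proof -
  have "ennreal (indicator hplane p * (1 - (norm p)\<^sup>2) powr (-3/2))
      = ennreal (klein_density (fst p) (snd p))" for p
    using powr_minus_three_halves[of "1 - (norm p)\<^sup>2"]
    by (cases p) (auto simp: klein_density_def hplane_iff norm_pair_sq indicator_def)
  then show ?thesis
    by (simp add: harea_measure_def lborel_prod)
qed

lemma sets_harea_measure [simp]: "sets harea_measure = sets borel"
  by (simp add: harea_measure_def)

lemma emeasure_harea_measure:
  assumes "S \<in> sets borel"
  shows "emeasure harea_measure S =
     (\<integral>\<^sup>+x. (\<integral>\<^sup>+y. ennreal (klein_density x y) * indicator S (x, y) \<partial>lborel) \<partial>lborel)" (is ?xy)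
    and "emeasure harea_measure S =
     (\<integral>\<^sup>+y. (\<integral>\<^sup>+x. ennreal (klein_density x y) * indicator S (x, y) \<partial>lborel) \<partial>lborel)" (is ?yx)
proof -
  have S [measurable]: "S \<in> sets (borel \<Otimes>\<^sub>M borel)"
    using assms by (subst borel_prod)
  have "emeasure harea_measure S =
      (\<integral>\<^sup>+p. ennreal (klein_density (fst p) (snd p)) * indicator S p \<partial>(lborel \<Otimes>\<^sub>M lborel))"
    unfolding harea_measure_eq by (subst emeasure_density) auto
  moreover have "(\<lambda>p. ennreal (klein_density (fst p) (snd p)) * indicator S p)
      \<in> borel_measurable (lborel \<Otimes>\<^sub>M lborel)"
    by measurable
  ultimately show ?xy ?yx
    using lborel.nn_integral_fst lborel_pair.nn_integral_snd by fastforce+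
qed

text \<open>The antiderivative of the density along a vertical chord is
\<open>y / ((1 - x\<^sup>2) * \<surd>(1 - x\<^sup>2 - y\<^sup>2))\<close>.\<close>

lemma nn_integral_klein_density_vertical:
  assumes x: "x\<^sup>2 < 1" and Y: "0 \<le> Y" "x\<^sup>2 + Y\<^sup>2 < 1"
  shows "(\<integral>\<^sup>+y. ennreal (klein_density x y) * indicator {0..Y} y \<partial>lborel)
           = ennreal (Y / ((1 - x\<^sup>2) * sqrt (1 - (x\<^sup>2 + Y\<^sup>2))))"
proof -
  define q where "q = 1 - x\<^sup>2"
  define F where "F = (\<lambda>y. y / (q * sqrt (1 - (x\<^sup>2 + y\<^sup>2))))"
  have q: "0 < q"
    using x by (simp add: q_def)
  have in_disc: "x\<^sup>2 + y\<^sup>2 < 1" if "0 \<le> y" "y \<le> Y" for y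
    using power_mono[OF that(2,1), of 2] Y by simp
  have "(\<integral>\<^sup>+y. ennreal (klein_density x y) * indicator {0..Y} y \<partial>lborel)
      = (\<integral>\<^sup>+y. ennreal (klein_density x y) * indicator {0<..<Y} y \<partial>lborel)"
    by (intro nn_integral_cong_AE,
        use AE_lborel_singleton[of 0] AE_lborel_singleton[of Y] in eventually_elim)
      (auto simp: indicator_def)
  also have "\<dots> = ennreal (F Y - F 0)"
  proof (rule nn_integral_FTC_interior[OF Y(1)])
    show "continuous_on {0..Y} F"
      unfolding F_def using in_disc q by (intro continuous_intros) force
  next
    fix y assume y: "0 < y" "y < Y"
    define r where "r = sqrt (1 - (x\<^sup>2 + y\<^sup>2))"
    have xy: "x\<^sup>2 + y\<^sup>2 < 1"
      using in_disc[of y] y by simp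
    then have r: "0 < r" "r\<^sup>2 = 1 - (x\<^sup>2 + y\<^sup>2)"
      by (auto simp: r_def)
    have "((\<lambda>y. 1 - (x\<^sup>2 + y\<^sup>2)) has_real_derivative - 2 * y) (at y)"
      by (auto intro!: derivative_eq_intros)
    from DERIV_chain2[OF DERIV_real_sqrt this] xy
    have dr: "((\<lambda>y. sqrt (1 - (x\<^sup>2 + y\<^sup>2))) has_real_derivative - y / r) (at y)"
      by (simp add: r_def field_simps)
    from DERIV_divide[OF DERIV_ident DERIV_cmult[OF dr, of q], folded r_def] q r(1)
    have "(F has_real_derivative (1 * (q * r) - y * (q * (- y / r))) / (q * r * (q * r))) (at y)"
      by (simp add: F_def)
    also have "(1 * (q * r) - y * (q * (- y / r))) / (q * r * (q * r)) = (r\<^sup>2 + y\<^sup>2) / (q * (r\<^sup>2 * r))"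
      using q r(1) by (simp add: field_simps power2_eq_square)
    also have "\<dots> = 1 / (r\<^sup>2 * r)"
      using q by (simp add: r(2) q_def)
    also have "\<dots> = klein_density x y"
      using xy r(1) by (simp add: r(2) klein_density_def flip: r_def)
    finally show "(F has_real_derivative klein_density x y) (at y)" .
    show "0 \<le> klein_density x y"
      using xy by (simp add: klein_density_def)
  qed
  finally show ?thesis
    by (simp add: F_def q_def)
qed

text \<open>The graph may reach the unit circle over the end points \<open>0\<close> and \<open>a\<close>, as the top side of the
frustum does at \<open>A0\<close>; these two vertical slices are negligible.\<close>

lemma emeasure_harea_under_graph:
  fixes Y :: "real \<Rightarrow> real"
  assumes S: "{(x, y). 0 \<le> x \<and> x \<le> a \<and> 0 \<le> y \<and> y \<le> Y x} \<in> sets borel" (is "?S \<in> _")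
    and Y: "\<And>x. 0 < x \<Longrightarrow> x < a \<Longrightarrow> 0 \<le> Y x \<and> x\<^sup>2 + (Y x)\<^sup>2 < 1"
  shows "emeasure harea_measure {(x, y). 0 \<le> x \<and> x \<le> a \<and> 0 \<le> y \<and> y \<le> Y x} =
    (\<integral>\<^sup>+x. ennreal (Y x / ((1 - x\<^sup>2) * sqrt (1 - (x\<^sup>2 + (Y x)\<^sup>2)))) * indicator {0<..<a} x \<partial>lborel)"
  unfolding emeasure_harea_measure(1)[OF S]
proof (intro nn_integral_cong_AE,
    use AE_lborel_singleton[of 0] AE_lborel_singleton[of a] in eventually_elim)
  fix x :: real assume x: "x \<noteq> 0" "x \<noteq> a"
  show "(\<integral>\<^sup>+y. ennreal (klein_density x y) * indicator ?S (x, y) \<partial>lborel) =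
      ennreal (Y x / ((1 - x\<^sup>2) * sqrt (1 - (x\<^sup>2 + (Y x)\<^sup>2)))) * indicator {0<..<a} x"
  proof (cases "0 < x \<and> x < a")
    case True
    have x2: "x\<^sup>2 < 1"
      using Y[of x] True by (smt (verit) zero_le_power2)
    have ind: "indicator ?S (x, y) = (indicator {0..Y x} y :: ennreal)" for y
      using True by (auto simp: indicator_def)
    show ?thesis
      using nn_integral_klein_density_vertical[OF x2, of "Y x"] Y[of x] True by (simp add: ind)
  next
    case False
    then show ?thesis
      using x by (auto simp: indicator_def)
  qed
qed

section \<open>Horodiscs centred at the ideal vertex\<close>

text \<open>If \<open>s = tanh d\<close> then this is \<open>exp (- d)\<close>: the point \<open>(0, s)\<close> lies at distance \<open>d\<close> from the centre of
the disc, and a horocycle piece seen from \<open>A0\<close> shrinks by the factor \<open>exp (- d)\<close> when the horocycle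
is moved by \<open>d\<close> towards \<open>A0\<close>.\<close>

definition horo_size :: "real \<Rightarrow> real" where
  "horo_size s = sqrt ((1 - s) / (1 + s))"

lemma mem_frustum_horodisc_horo_size_iff:
  assumes "0 \<le> s" "s < 1"
  shows "(x, y) \<in> frustum_horodisc s \<longleftrightarrow>
           x\<^sup>2 + y\<^sup>2 < 1 \<and> 1 - y \<le> horo_size s * sqrt (1 - (x\<^sup>2 + y\<^sup>2))"
proof -
  have "1 - s\<^sup>2 = (1 - s) * (1 + s)"
    by (simp add: power2_eq_square algebra_simps)
  then have "(1 - s) / sqrt (1 - s\<^sup>2) = (1 - s) / sqrt (1 - s) / sqrt (1 + s)"
    by (simp add: real_sqrt_mult)
  also have "\<dots> = horo_size s"
    using assms by (simp add: real_div_sqrt horo_size_def real_sqrt_divide)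
  finally have "(1 - s) / sqrt (1 - s\<^sup>2) = horo_size s" .
  then show ?thesis
    unfolding mem_frustum_horodisc_iff[OF assms] by (auto simp: pos_divide_le_eq)
qed

lemma horo_size_pos: "0 < horo_size s" if "0 \<le> s" "s < 1"
  using that by (simp add: horo_size_def)

lemma horo_size_sq: "(horo_size s)\<^sup>2 = (1 - s) / (1 + s)" if "0 \<le> s" "s < 1"
  using that by (simp add: horo_size_def)

lemma horo_size_antimono: "horo_size t \<le> horo_size s" if "0 \<le> s" "s \<le> t" "t < 1"
proof -
  have "(1 - t) / (1 + t) \<le> (1 - s) / (1 + s)"
    using that by (intro frac_le) auto
  then show ?thesis
    by (simp add: horo_size_def)
qed

lemma horo_size_le_1: "horo_size s \<le> 1" if "0 \<le> s" "s < 1"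
  using horo_size_antimono[of 0 s] that by (simp add: horo_size_def)

text \<open>With \<open>s = tanh d\<close> this reads \<open>sinh d = (exp d - exp (- d)) / 2\<close>.\<close>

lemma sinh_artanh_eq_horo_size:
  assumes "0 \<le> s" "s < 1"
  shows "s / sqrt (1 - s\<^sup>2) = (1 / horo_size s - horo_size s) / 2"
proof -
  define u where "u = sqrt (1 - s)"
  define v where "v = sqrt (1 + s)"
  have uv: "0 < u" "0 < v" "u * u = 1 - s" "v * v = 1 + s"
    using assms by (auto simp: u_def v_def)
  have "1 - s\<^sup>2 = (1 - s) * (1 + s)"
    by (simp add: power2_eq_square algebra_simps)
  then have "sqrt (1 - s\<^sup>2) = u * v"
    by (simp add: u_def v_def real_sqrt_mult)
  moreover have "horo_size s = u / v"
    by (simp add: horo_size_def u_def v_def real_sqrt_divide)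
  moreover have "v / u - u / v = (v * v - u * u) / (u * v)"
    using uv(1,2) by (simp add: diff_divide_distrib)
  ultimately show ?thesis
    by (simp add: uv(3,4))
qed

lemma sinh_artanh_mono:
  assumes "0 \<le> s" "s \<le> t" "t < 1"
  shows "s / sqrt (1 - s\<^sup>2) \<le> t / sqrt (1 - (t::real)\<^sup>2)"
proof -
  have "t\<^sup>2 < 1"
    using assms by (simp add: abs_square_less_1)
  then show ?thesis
    using assms by (intro frac_le) (auto intro: power_mono)
qed

lemma horo_size_sqrt:
  assumes a: "0 < a" "a < 1"
  shows "horo_size (sqrt (1 - a\<^sup>2)) = (1 - sqrt (1 - a\<^sup>2)) / a"
proof -
  define c where "c = sqrt (1 - a\<^sup>2)"
  have "0 < a\<^sup>2" "a\<^sup>2 < 1"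
    using a by (simp_all add: abs_square_less_1)
  then have c: "0 < c" "c < 1" "c\<^sup>2 = 1 - a\<^sup>2"
    by (simp_all add: c_def)
  then have a_sq: "a\<^sup>2 = (1 - c) * (1 + c)"
    by (simp add: power2_eq_square algebra_simps)
  have "((1 - c) / a)\<^sup>2 = (1 - c) / (1 + c)"
    unfolding power_divide a_sq using c(1,2) by (simp add: power2_eq_square)
  then show ?thesis
    unfolding horo_size_def c_def[symmetric]
    by (rule real_sqrt_unique) (use a(1) c(2) in simp)
qed

lemma horo_size_type2:
  assumes a: "0 < a" "a < 1"
  shows "horo_size (1 - 2 * a\<^sup>2) = a / sqrt (1 - a\<^sup>2)"
proof -
  have "(1 - (1 - 2 * a\<^sup>2)) / (1 + (1 - 2 * a\<^sup>2)) = (2 * a\<^sup>2) / (2 * (1 - a\<^sup>2))"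
    by simp
  also have "\<dots> = a\<^sup>2 / (1 - a\<^sup>2)"
    by (rule mult_divide_mult_cancel_left) simp
  finally have ratio: "(1 - (1 - 2 * a\<^sup>2)) / (1 + (1 - 2 * a\<^sup>2)) = a\<^sup>2 / (1 - a\<^sup>2)" .
  show ?thesis
    unfolding horo_size_def ratio using a(1) by (simp add: real_sqrt_divide)
qed

lemma mem_frustum_horodisc_sq_iff:
  assumes s: "0 \<le> s" "s < 1"
  shows "(x, y) \<in> frustum_horodisc s \<longleftrightarrow>
           x\<^sup>2 + y\<^sup>2 < 1 \<and> (1 - y)\<^sup>2 * (1 + s) \<le> (1 - s) * (1 - (x\<^sup>2 + y\<^sup>2))"
proof (cases "x\<^sup>2 + y\<^sup>2 < 1")
  case True
  then have "y\<^sup>2 < 1"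
    by (smt (verit) zero_le_power2)
  then have y: "y < 1"
    by (simp add: abs_square_less_1)
  have "0 \<le> horo_size s * sqrt (1 - (x\<^sup>2 + y\<^sup>2))"
    using True horo_size_pos[OF s] by simp
  then have "1 - y \<le> horo_size s * sqrt (1 - (x\<^sup>2 + y\<^sup>2)) \<longleftrightarrow>
      (1 - y)\<^sup>2 \<le> (horo_size s * sqrt (1 - (x\<^sup>2 + y\<^sup>2)))\<^sup>2"
    using y by (simp add: abs_le_square_iff[symmetric])
  also have "\<dots> \<longleftrightarrow> (1 - y)\<^sup>2 \<le> (1 - s) * (1 - (x\<^sup>2 + y\<^sup>2)) / (1 + s)"
    using True by (simp add: power_mult_distrib horo_size_sq[OF s])
  also have "\<dots> \<longleftrightarrow> (1 - y)\<^sup>2 * (1 + s) \<le> (1 - s) * (1 - (x\<^sup>2 + y\<^sup>2))"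
    using s by (intro pos_le_divide_eq) simp
  finally show ?thesis
    unfolding mem_frustum_horodisc_horo_size_iff[OF s] by blast
qed (simp add: mem_frustum_horodisc_horo_size_iff[OF s])

text \<open>In the coordinates \<open>x = v m\<close>, \<open>y = 1 - v\<close> a ray from \<open>A0\<close> is a line \<open>m = const\<close>, and
\<open>1 - x\<^sup>2 - y\<^sup>2 = v (2 - C v)\<close> with \<open>C = 1 + m\<^sup>2\<close>. The density times the Jacobian \<open>v\<close> has the
antiderivative \<open>\<surd>(v / (2 - C v))\<close>, which is exactly the quantity that the horodisc bounds by \<open>k\<close>.
Hence every ray contributes the same amount \<open>k\<close>.\<close>

lemma nn_integral_klein_density_ray:
  fixes m k :: real
  assumes k: "0 < k"
  shows "(\<integral>\<^sup>+v. ennreal (v * klein_density (v * m) (1 - v)) *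
            indicator {v. 0 < v \<and> (v * m)\<^sup>2 + (1 - v)\<^sup>2 < 1 \<and>
                          v \<le> k * sqrt (1 - ((v * m)\<^sup>2 + (1 - v)\<^sup>2))} v \<partial>lborel)
         = ennreal k"
proof -
  define C where "C = 1 + m\<^sup>2"
  define V where "V = 2 * k\<^sup>2 / (1 + k\<^sup>2 * C)"
  define F where "F = (\<lambda>v. sqrt (v / (2 - C * v)))"
  let ?f = "\<lambda>v. v * klein_density (v * m) (1 - v)"
  have C: "0 < C"
    unfolding C_def by (simp add: add_pos_nonneg)
  have den: "0 < 1 + k\<^sup>2 * C"
    using C by (simp add: add_pos_nonneg)
  have V: "0 < V"
    using k den by (simp add: V_def)
  have r2: "1 - ((v * m)\<^sup>2 + (1 - v)\<^sup>2) = v * (2 - C * v)" for v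
    by (simp add: C_def power2_eq_square algebra_simps)
  have disc: "(v * m)\<^sup>2 + (1 - v)\<^sup>2 < 1 \<longleftrightarrow> C * v < 2" if "0 < v" for v
  proof -
    have "(v * m)\<^sup>2 + (1 - v)\<^sup>2 < 1 \<longleftrightarrow> 0 < v * (2 - C * v)"
      using r2[of v] by linarith
    then show ?thesis
      using that by (simp add: zero_less_mult_iff)
  qed
  have le_V: "v \<le> V \<longleftrightarrow> v \<le> k\<^sup>2 * (2 - C * v)" for v
    using den unfolding V_def by (simp add: pos_le_divide_eq algebra_simps)
  have CV: "2 - C * V = 2 / (1 + k\<^sup>2 * C)"
    using den by (simp add: V_def field_simps)
  have below_V: "C * v < 2" if "v \<le> V" for v
  proof -
    have "C * v \<le> C * V"
      using C that by simp
    moreover have "0 < 2 - C * V"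
      unfolding CV using den by simp
    ultimately show ?thesis by simp
  qed
  have region: "0 < v \<and> (v * m)\<^sup>2 + (1 - v)\<^sup>2 < 1 \<and> v \<le> k * sqrt (1 - ((v * m)\<^sup>2 + (1 - v)\<^sup>2))
      \<longleftrightarrow> 0 < v \<and> v \<le> V" for v
  proof (cases "0 < v \<and> C * v < 2")
    case True
    then have pos: "0 < v * (2 - C * v)"
      by simp
    have "v \<le> k * sqrt (v * (2 - C * v)) \<longleftrightarrow> v\<^sup>2 \<le> (k * sqrt (v * (2 - C * v)))\<^sup>2"
      using True k pos by (simp add: abs_le_square_iff[symmetric] abs_mult)
    also have "\<dots> \<longleftrightarrow> v * v \<le> v * (k\<^sup>2 * (2 - C * v))"
      using pos by (simp add: power_mult_distrib power2_eq_square mult_ac)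
    also have "\<dots> \<longleftrightarrow> v \<le> V"
      using True by (simp add: le_V)
    finally show ?thesis
      using True disc unfolding r2 by simp
  next
    case False
    then show ?thesis
      using disc below_V by auto
  qed
  have "(\<integral>\<^sup>+v. ennreal (?f v) * indicator {v. 0 < v \<and> v \<le> V} v \<partial>lborel)
      = (\<integral>\<^sup>+v. ennreal (?f v) * indicator {0<..<V} v \<partial>lborel)"
    by (intro nn_integral_cong_AE, use AE_lborel_singleton[of V] in eventually_elim)
      (auto simp: indicator_def)
  also have "\<dots> = ennreal (F V - F 0)"
  proof (rule nn_integral_FTC_interior)
    show "0 \<le> V"
      using V by simp
    show "continuous_on {0..V} F"
      unfolding F_def using below_V by (intro continuous_intros) fastforce
  next
    fix v assume v: "0 < v" "v < V"
    define d where "d = 2 - C * v"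
    have d: "0 < d"
      using below_V[of v] v by (simp add: d_def)
    have f: "?f v = 1 / (d * sqrt (v * d))"
      using v(1) d disc[of v] by (simp add: klein_density_def r2 flip: d_def) (simp add: d_def)
    have "((\<lambda>v. 2 - C * v) has_real_derivative - C) (at v)"
      by (auto intro!: derivative_eq_intros)
    from DERIV_divide[OF DERIV_ident this, folded d_def]
    have "((\<lambda>v. v / (2 - C * v)) has_real_derivative 2 / (d * d)) (at v)"
      using d by (simp add: d_def)
    from DERIV_chain2[OF DERIV_real_sqrt this, folded d_def]
    have "(F has_real_derivative inverse (sqrt (v / d)) / 2 * (2 / (d * d))) (at v)"
      using v d by (simp add: F_def)
    also have "inverse (sqrt (v / d)) / 2 * (2 / (d * d)) = 1 / (d * (sqrt (v / d) * d))"
      by (simp add: field_simps)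
    also have "sqrt (v / d) * d = sqrt (v * d)"
    proof -
      have "sqrt (v / d) * d = sqrt v * (d / sqrt d)"
        by (simp add: real_sqrt_divide)
      then show ?thesis
        using d by (simp add: real_div_sqrt real_sqrt_mult)
    qed
    finally show "(F has_real_derivative ?f v) (at v)"
      unfolding f .
    show "0 \<le> ?f v"
      unfolding f using v d by simp
  qed
  also have "V / (2 - C * V) = k\<^sup>2"
    unfolding CV using den by (simp add: V_def)
  then have "F V - F 0 = k"
    using k by (simp add: F_def)
  finally show ?thesis
    unfolding region .
qed

text \<open>Between the side \<open>A0 A1\<close> (\<open>m = 0\<close>) and the side \<open>A0 P0\<close> (\<open>m = 1 / a\<close>) every ray from \<open>A0\<close>
contributes \<open>k\<close>. The change to ray coordinates is a scaling of \<open>x\<close> for fixed \<open>v\<close>, followed by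
Tonelli's theorem.\<close>

lemma emeasure_harea_horodisc_sector:
  fixes a k :: real
  assumes a: "0 < a" and k: "0 < k"
    and S: "{(x, y). 0 \<le> x \<and> a * x \<le> 1 - y \<and> x\<^sup>2 + y\<^sup>2 < 1 \<and>
                     1 - y \<le> k * sqrt (1 - (x\<^sup>2 + y\<^sup>2))} \<in> sets borel" (is "?S \<in> _")
  shows "emeasure harea_measure {(x, y). 0 \<le> x \<and> a * x \<le> 1 - y \<and> x\<^sup>2 + y\<^sup>2 < 1 \<and>
                     1 - y \<le> k * sqrt (1 - (x\<^sup>2 + y\<^sup>2))} = ennreal (k / a)"
proof -
  have S' [measurable]: "?S \<in> sets (borel \<Otimes>\<^sub>M borel)"
    using S by (subst borel_prod)
  define f where "f = (\<lambda>x y. ennreal (klein_density x y) * indicator ?S (x, y))"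
  define g where "g = (\<lambda>m v. if 0 < v then ennreal v * f (v * m) (1 - v) else 0)"
  have "(\<lambda>p. ennreal (klein_density (fst p) (snd p)) * indicator ?S p)
      \<in> borel_measurable (borel \<Otimes>\<^sub>M borel)"
    by measurable
  then have f_meas: "(\<lambda>p. f (fst p) (snd p)) \<in> borel_measurable (borel \<Otimes>\<^sub>M borel)"
    by (simp add: f_def)
  have f_comp [measurable (raw)]: "(\<lambda>z. f (h z) (h' z)) \<in> borel_measurable M"
    if [measurable]: "h \<in> borel_measurable M" "h' \<in> borel_measurable M" for h h' and M :: "'z measure"
    using measurable_compose[OF measurable_Pair[OF that] f_meas] by simp
  have scale: "(\<integral>\<^sup>+x. f x (1 - v) \<partial>lborel) = (\<integral>\<^sup>+m. g m v \<partial>lborel)" for v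
  proof (cases "0 < v")
    case True
    have "(\<integral>\<^sup>+x. f x (1 - v) \<partial>lborel) = ennreal \<bar>v\<bar> * (\<integral>\<^sup>+m. f (0 + v * m) (1 - v) \<partial>lborel)"
      using True by (intro nn_integral_real_affine) auto
    also have "\<dots> = (\<integral>\<^sup>+m. ennreal v * f (v * m) (1 - v) \<partial>lborel)"
      using True by (simp add: nn_integral_cmult)
    finally show ?thesis
      using True by (simp add: g_def)
  next
    case False
    then have "1\<^sup>2 \<le> (1 - v)\<^sup>2"
      by (intro power_mono) auto
    then have "\<not> x\<^sup>2 + (1 - v)\<^sup>2 < 1" for x :: real
      using zero_le_power2[of x] unfolding power_one by linarith
    then show ?thesis
      using False by (simp add: f_def g_def)
  qed
  have ray: "(\<integral>\<^sup>+v. g m v \<partial>lborel) = ennreal k * indicator {0..1 / a} m" for m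
  proof (cases "m \<in> {0..1 / a}")
    case True
    then have am: "0 \<le> m" "a * m \<le> 1"
      using a by (auto simp: field_simps)
    have "g m v = ennreal (v * klein_density (v * m) (1 - v)) *
            indicator {v. 0 < v \<and> (v * m)\<^sup>2 + (1 - v)\<^sup>2 < 1 \<and>
                          v \<le> k * sqrt (1 - ((v * m)\<^sup>2 + (1 - v)\<^sup>2))} v" for v
    proof (cases "0 < v")
      case True
      then have "a * (v * m) \<le> v"
        using mult_left_mono[OF am(2), of v] by (simp add: mult_ac)
      then show ?thesis
        using True am(1) by (simp add: g_def f_def indicator_def ennreal_mult')
    qed (simp add: g_def)
    then show ?thesis
      using nn_integral_klein_density_ray[OF k, of m] True by simp
  next
    case False
    have "g m v = 0" for v
    proof (cases "0 < v")
      case True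
      have "\<not> (0 \<le> v * m \<and> a * (v * m) \<le> v)"
      proof
        assume *: "0 \<le> v * m \<and> a * (v * m) \<le> v"
        then have "0 \<le> m" "v * (a * m) \<le> v * 1"
          using True by (simp_all add: zero_le_mult_iff mult_ac)
        then have "0 \<le> m" "a * m \<le> 1"
          using True by simp_all
        then show False
          using False a by (simp add: field_simps)
      qed
      then show ?thesis
        by (auto simp: g_def f_def)
    qed (simp add: g_def)
    then show ?thesis
      using False by simp
  qed
  have "emeasure harea_measure ?S = (\<integral>\<^sup>+y. (\<integral>\<^sup>+x. f x y \<partial>lborel) \<partial>lborel)"
    unfolding f_def by (rule emeasure_harea_measure(2)[OF S])
  also have "\<dots> = ennreal \<bar>- 1\<bar> * (\<integral>\<^sup>+v. (\<integral>\<^sup>+x. f x (1 + - 1 * v) \<partial>lborel) \<partial>lborel)"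
    by (rule nn_integral_real_affine) auto
  also have "\<dots> = (\<integral>\<^sup>+v. (\<integral>\<^sup>+m. g m v \<partial>lborel) \<partial>lborel)"
    by (simp add: scale)
  also have "\<dots> = (\<integral>\<^sup>+m. (\<integral>\<^sup>+v. g m v \<partial>lborel) \<partial>lborel)"
    unfolding g_def by (rule lborel_pair.Fubini') measurable
  also have "\<dots> = ennreal k * ennreal (1 / a)"
    using a by (simp add: ray nn_integral_cmult)
  also have "\<dots> = ennreal (k / a)"
    using a k by (simp flip: ennreal_mult)
  finally show ?thesis .
qed

section \<open>The frustum and its hypercycle strip\<close>

lemma frustum_eq:
  assumes a: "0 < a" "a < 1"
  shows "frustum a = {(x, y). 0 \<le> x \<and> x \<le> a \<and> 0 \<le> y \<and> y \<le> 1 - a * x}" (is "_ = ?Q")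
proof
  have "?Q = {p. 0 \<le> inner (1, 0) p} \<inter> {p. inner (1, 0) p \<le> a} \<inter> {p. 0 \<le> inner (0, 1) p}
      \<inter> {p. inner (a, 1) p \<le> 1}"
    by auto
  then have "convex ?Q"
    by (simp only:) (intro convex_Int convex_halfspace_le convex_halfspace_ge)
  moreover have "a * a \<le> 1"
    using a by (simp add: mult_le_one)
  ultimately show "frustum a \<subseteq> ?Q"
    unfolding frustum_def using a
    by (intro hull_minimal) (auto simp: A0_def A1_def P0_def P1_def power2_eq_square)
next
  let ?H = "frustum a"
  have H: "convex ?H" "A0 \<in> ?H" "A1 \<in> ?H" "P1 a \<in> ?H" "P0 a \<in> ?H"
    unfolding frustum_def by (auto simp: convex_convex_hull intro: hull_inc)
  show "?Q \<subseteq> ?H"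
  proof
    fix p assume "p \<in> ?Q"
    then obtain x y where p: "p = (x, y)" and x: "0 \<le> x" "x \<le> a" and y: "0 \<le> y" "y \<le> 1 - a * x"
      by auto
    define t where "t = x / a"
    have t: "0 \<le> t" "t \<le> 1" "t * a = x"
      using a x by (auto simp: t_def)
    have bottom: "(x, 0) \<in> ?H"
      using convexD_alt[OF H(1) H(3,4) t(1,2)] t(3) by (simp add: A1_def P1_def)
    have "(1 - t) *\<^sub>R A0 + t *\<^sub>R P0 a = (x, 1 - a * x)"
      by (simp add: A0_def P0_def t(3)[symmetric] power2_eq_square algebra_simps)
    then have top: "(x, 1 - a * x) \<in> ?H"
      using convexD_alt[OF H(1) H(2,5) t(1,2)] by simp
    have pos: "0 < 1 - a * x"
    proof -
      have "a * x \<le> a * a"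
        using a x by simp
      moreover have "a * a < 1 * 1"
        using a by (intro mult_strict_mono) auto
      ultimately show ?thesis by simp
    qed
    define u where "u = y / (1 - a * x)"
    have u: "0 \<le> u" "u \<le> 1" "u * (1 - a * x) = y"
      using y pos by (auto simp: u_def)
    have "(1 - u) *\<^sub>R (x, 0) + u *\<^sub>R (x, 1 - a * x) = p"
      by (simp add: p u(3)[symmetric] algebra_simps)
    then show "p \<in> ?H"
      using convexD_alt[OF H(1) bottom top u(1,2)] by simp
  qed
qed

text \<open>The hypercycle through \<open>P0\<close> is tangent to the line \<open>A0 P0\<close> there, because
\<open>(1 - a x)\<^sup>2 - (1 - a\<^sup>2) (1 - x\<^sup>2) = (a - x)\<^sup>2\<close>.\<close>

lemma top_side_above_hypercycle:
  fixes a x :: real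
  assumes "0 < a" "a < 1" "0 \<le> x" "x < a"
  shows "(1 - a\<^sup>2) * (1 - x\<^sup>2) < (1 - a * x)\<^sup>2" "x\<^sup>2 + (1 - a * x)\<^sup>2 < 1 \<longleftrightarrow> 0 < x"
proof -
  have "0 < (a - x)\<^sup>2"
    using assms by simp
  moreover have "(1 - a * x)\<^sup>2 - (1 - a\<^sup>2) * (1 - x\<^sup>2) = (a - x)\<^sup>2"
    by (simp add: power2_eq_square algebra_simps)
  ultimately show "(1 - a\<^sup>2) * (1 - x\<^sup>2) < (1 - a * x)\<^sup>2"
    by linarith
  have "1 - (x\<^sup>2 + (1 - a * x)\<^sup>2) = x * ((a - x) + a * (1 - a * x))"
    by (simp add: power2_eq_square algebra_simps)
  moreover have "0 < (a - x) + a * (1 - a * x)"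
  proof -
    have "a * x < 1 * 1"
      using assms by (intro mult_strict_mono') auto
    then show ?thesis
      using assms by (intro add_pos_pos) auto
  qed
  ultimately have "0 < 1 - (x\<^sup>2 + (1 - a * x)\<^sup>2) \<longleftrightarrow> 0 < x"
    by (simp add: zero_less_mult_iff)
  then show "x\<^sup>2 + (1 - a * x)\<^sup>2 < 1 \<longleftrightarrow> 0 < x"
    by simp
qed

text \<open>By Gauss-Bonnet the part of the frustum to the left of the vertical line through \<open>x\<close> has area
\<open>\<pi>\<close> minus its angle at \<open>(x, 1 - a x)\<close>. Expressing that angle through the poles of the two lines
suggests the antiderivative \<open>arccos ((a - x) / (a * \<surd>(1 - x\<^sup>2)))\<close>.\<close>

lemma emeasure_harea_frustum:
  assumes a: "0 < a" "a < 1"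
  shows "emeasure harea_measure (frustum a) = ennreal (pi / 2)"
proof -
  define c where "c = (\<lambda>x. (a - x) / (a * sqrt (1 - x\<^sup>2)))"
  have "{(x, y). 0 \<le> x \<and> x \<le> a \<and> 0 \<le> y \<and> y \<le> 1 - a * x} \<in> sets borel"
    unfolding case_prod_beta by measurable
  moreover have ax: "0 < 1 - a * x" if "0 < x" "x < a" for x
  proof -
    have "a * x < 1 * 1"
      using a that by (intro mult_strict_mono') auto
    then show ?thesis by simp
  qed
  ultimately have "emeasure harea_measure (frustum a) =
      (\<integral>\<^sup>+x. ennreal ((1 - a * x) / ((1 - x\<^sup>2) * sqrt (1 - (x\<^sup>2 + (1 - a * x)\<^sup>2))))
        * indicator {0<..<a} x \<partial>lborel)"
    unfolding frustum_eq[OF a] using a top_side_above_hypercycle(2)[OF a]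
    by (intro emeasure_harea_under_graph) (auto simp: less_imp_le)
  also have "\<dots> = ennreal (arccos (c a) - arccos (c 0))"
  proof (rule nn_integral_FTC_interior)
    show "0 \<le> a"
      using a by simp
    have x2: "x\<^sup>2 < 1" if "0 \<le> x" "x \<le> a" for x
      using a that by (simp add: abs_square_less_1)
    have c2: "(c x)\<^sup>2 = 1 - (1 - (x\<^sup>2 + (1 - a * x)\<^sup>2)) / (a\<^sup>2 * (1 - x\<^sup>2))" if "0 \<le> x" "x \<le> a" for x
    proof -
      have "(c x)\<^sup>2 = (a - x)\<^sup>2 / (a\<^sup>2 * (1 - x\<^sup>2))"
        using x2[OF that] by (simp add: c_def power_divide power_mult_distrib)
      also have "(a - x)\<^sup>2 = a\<^sup>2 * (1 - x\<^sup>2) - (1 - (x\<^sup>2 + (1 - a * x)\<^sup>2))"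
        by (simp add: power2_eq_square algebra_simps)
      finally show ?thesis
        using a x2[OF that] by (simp add: diff_divide_distrib)
    qed
    have c_range: "0 \<le> c x \<and> c x \<le> 1" if "0 \<le> x" "x \<le> a" for x
    proof -
      have nonneg: "0 \<le> c x"
        using a that x2[OF that] by (simp add: c_def)
      have "x\<^sup>2 + (1 - a * x)\<^sup>2 \<le> 1"
      proof (cases "x = a")
        case True
        then show ?thesis
          using P0_in_hplane[OF a] by (simp add: power2_eq_square)
      next
        case False
        then show ?thesis
          using top_side_above_hypercycle(2)[OF a, of x] that by (cases "x = 0") auto
      qed
      then have "(c x)\<^sup>2 \<le> 1"
        unfolding c2[OF that] using a x2[OF that] by simp
      then show ?thesis
        using nonneg by (simp add: abs_square_le_1)
    qed
    have c_cont: "continuous_on {0..a} c"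
      unfolding c_def using a x2 by (intro continuous_intros) force
    show "continuous_on {0..a} (\<lambda>x. arccos (c x))"
      using c_range by (intro continuous_on_arccos c_cont) force
  next
    fix x assume x: "0 < x" "x < a"
    define w where "w = sqrt (1 - x\<^sup>2)"
    define r where "r = sqrt (1 - (x\<^sup>2 + (1 - a * x)\<^sup>2))"
    have x2: "x\<^sup>2 < 1"
      using a x by (simp add: abs_square_less_1)
    then have w: "0 < w" "w\<^sup>2 = 1 - x\<^sup>2"
      by (simp_all add: w_def)
    have r: "0 < r" "r\<^sup>2 = 1 - (x\<^sup>2 + (1 - a * x)\<^sup>2)"
      using top_side_above_hypercycle(2)[OF a, of x] x by (simp_all add: r_def)
    have "((\<lambda>x. 1 - x\<^sup>2) has_real_derivative - 2 * x) (at x)"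
      by (auto intro!: derivative_eq_intros)
    from DERIV_chain2[OF DERIV_real_sqrt this] x2
    have dw: "((\<lambda>x. sqrt (1 - x\<^sup>2)) has_real_derivative - x / w) (at x)"
      by (simp add: w_def field_simps)
    have dn: "((\<lambda>x. a - x) has_real_derivative - 1) (at x)"
      by (auto intro!: derivative_eq_intros)
    from DERIV_divide[OF dn DERIV_cmult[OF dw, of a], folded w_def] a w(1)
    have "(c has_real_derivative (- 1 * (a * w) - (a - x) * (a * (- x / w))) / (a * w * (a * w))) (at x)"
      by (simp add: c_def)
    also have "- 1 * (a * w) - (a - x) * (a * (- x / w)) = a * (- w\<^sup>2 + (a - x) * x) / w"
      using w(1) by (simp add: field_simps power2_eq_square)
    also have "\<dots> = - a * (1 - a * x) / w"
      unfolding w(2) by (simp add: algebra_simps power2_eq_square)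
    also have "- a * (1 - a * x) / w / (a * w * (a * w)) = - (1 - a * x) / (a * w ^ 3)"
      using a w(1) by (simp add: field_simps power3_eq_cube)
    finally have dc: "(c has_real_derivative - (1 - a * x) / (a * w ^ 3)) (at x)" .
    have c_eq: "c x = (a - x) / (a * w)"
      by (simp add: c_def w_def)
    have "(a - x)\<^sup>2 = a\<^sup>2 * w\<^sup>2 - r\<^sup>2"
      unfolding w(2) r(2) by (simp add: power2_eq_square algebra_simps)
    then have "(c x)\<^sup>2 = (a\<^sup>2 * w\<^sup>2 - r\<^sup>2) / (a\<^sup>2 * w\<^sup>2)"
      unfolding c_eq by (simp only: power_divide power_mult_distrib)
    then have c2: "1 - (c x)\<^sup>2 = (r / (a * w))\<^sup>2"
      using a(1) w(1) by (simp add: power_divide power_mult_distrib diff_divide_distrib)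
    moreover have "0 < (r / (a * w))\<^sup>2"
      using a w(1) r(1) by simp
    ultimately have "(c x)\<^sup>2 < 1"
      by linarith
    then have "\<bar>c x\<bar> < 1"
      by (simp add: abs_square_less_1)
    then have c1: "- 1 < c x" "c x < 1"
      by auto
    have s: "sqrt (1 - (c x)\<^sup>2) = r / (a * w)"
      unfolding c2 using a w(1) r(1) by simp
    have "((\<lambda>x. arccos (c x)) has_real_derivative
        inverse (- (r / (a * w))) * (- (1 - a * x) / (a * w ^ 3))) (at x)"
      using DERIV_chain2[OF DERIV_arccos[OF c1] dc] unfolding s .
    also have "inverse (- (r / (a * w))) * (- (1 - a * x) / (a * w ^ 3)) = (1 - a * x) / (w\<^sup>2 * r)"
      using a w(1) r(1) by (simp add: divide_simps power2_eq_square power3_eq_cube)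
    finally show "((\<lambda>x. arccos (c x)) has_real_derivative
        (1 - a * x) / ((1 - x\<^sup>2) * sqrt (1 - (x\<^sup>2 + (1 - a * x)\<^sup>2)))) (at x)"
      by (simp only: w(2) r_def)
    show "0 \<le> (1 - a * x) / ((1 - x\<^sup>2) * sqrt (1 - (x\<^sup>2 + (1 - a * x)\<^sup>2)))"
      using ax[OF x] w r(1) x2 unfolding r_def by simp
  qed
  also have "arccos (c a) - arccos (c 0) = pi / 2"
    using a by (simp add: c_def)
  finally show ?thesis .
qed

text \<open>With \<open>s = tanh r\<close> this is the classical \<open>sinh r\<close> times the length \<open>artanh a\<close> of the base side.\<close>

lemma emeasure_harea_hypercycle_strip:
  assumes a: "0 < a" "a < 1" and s: "0 \<le> s" "s < 1"
  shows "emeasure harea_measure {(x, y). 0 \<le> x \<and> x \<le> a \<and> 0 \<le> y \<and> y \<le> s * sqrt (1 - x\<^sup>2)}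
           = ennreal (s / sqrt (1 - s\<^sup>2) * artanh a)"
proof -
  have s2: "s\<^sup>2 < 1"
    using s by (simp add: abs_square_less_1)
  have x2: "x\<^sup>2 < 1" if "0 < x" "x < a" for x
    using a that by (simp add: abs_square_less_1)
  have gap: "1 - (x\<^sup>2 + (s * sqrt (1 - x\<^sup>2))\<^sup>2) = (1 - s\<^sup>2) * (1 - x\<^sup>2)" if "x\<^sup>2 < 1" for x
    using that by (simp add: power_mult_distrib algebra_simps)
  have graph: "0 \<le> s * sqrt (1 - x\<^sup>2) \<and> x\<^sup>2 + (s * sqrt (1 - x\<^sup>2))\<^sup>2 < 1" if "0 < x" "x < a" for x
  proof -
    have "0 < 1 - (x\<^sup>2 + (s * sqrt (1 - x\<^sup>2))\<^sup>2)"
      unfolding gap[OF x2[OF that]] using s2 x2[OF that] by simp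
    then show ?thesis
      using s x2[OF that] by simp
  qed
  have "{(x, y). 0 \<le> x \<and> x \<le> a \<and> 0 \<le> y \<and> y \<le> s * sqrt (1 - x\<^sup>2)} \<in> sets borel"
    unfolding case_prod_beta by measurable
  then have "emeasure harea_measure {(x, y). 0 \<le> x \<and> x \<le> a \<and> 0 \<le> y \<and> y \<le> s * sqrt (1 - x\<^sup>2)} =
      (\<integral>\<^sup>+x. ennreal (s * sqrt (1 - x\<^sup>2) / ((1 - x\<^sup>2) * sqrt (1 - (x\<^sup>2 + (s * sqrt (1 - x\<^sup>2))\<^sup>2))))
        * indicator {0<..<a} x \<partial>lborel)"
    by (rule emeasure_harea_under_graph) (rule graph)
  also have "\<dots> = (\<integral>\<^sup>+x. ennreal (s / sqrt (1 - s\<^sup>2) * (1 / (1 - x\<^sup>2)))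
        * indicator {0<..<a} x \<partial>lborel)"
  proof (rule nn_integral_cong)
    fix x :: real
    show "ennreal (s * sqrt (1 - x\<^sup>2) / ((1 - x\<^sup>2) * sqrt (1 - (x\<^sup>2 + (s * sqrt (1 - x\<^sup>2))\<^sup>2))))
        * indicator {0<..<a} x
        = ennreal (s / sqrt (1 - s\<^sup>2) * (1 / (1 - x\<^sup>2))) * indicator {0<..<a} x"
    proof (cases "x \<in> {0<..<a}")
      case True
      then show ?thesis
        using x2[of x] gap[of x] by (simp add: real_sqrt_mult mult.commute)
    qed simp
  qed
  also have "\<dots> = ennreal (s / sqrt (1 - s\<^sup>2) * artanh a - s / sqrt (1 - s\<^sup>2) * artanh 0)"
  proof (rule nn_integral_FTC_interior)
    show "0 \<le> a"
      using a by simp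
    show "continuous_on {0..a} (\<lambda>x. s / sqrt (1 - s\<^sup>2) * artanh x)"
      using a by (intro continuous_on_mult continuous_on_const continuous_on_artanh) auto
  next
    fix x assume x: "0 < x" "x < a"
    show "((\<lambda>x. s / sqrt (1 - s\<^sup>2) * artanh x) has_real_derivative s / sqrt (1 - s\<^sup>2) * (1 / (1 - x\<^sup>2))) (at x)"
      using a x by (intro DERIV_cmult artanh_real_has_field_derivative) auto
    show "0 \<le> s / sqrt (1 - s\<^sup>2) * (1 / (1 - x\<^sup>2))"
      using s s2 x2[OF x] by simp
  qed
  finally show ?thesis
    by simp
qed

section \<open>Admissible triples\<close>

lemma horodisc_misses_base_side:
  assumes a: "0 < a" "a < 1" and s: "0 \<le> s" "s < 1"
  shows "frustum_horodisc s \<inter> open_segment A1 (P1 a) = {}"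
proof -
  have "(t * a, 0) \<notin> frustum_horodisc s" if "0 < t" for t
  proof -
    have "0 < (1 - s) * (t * a)\<^sup>2"
      using a s that by simp
    then show ?thesis
      using s by (simp add: mem_frustum_horodisc_sq_iff algebra_simps)
  qed
  then show ?thesis
    by (auto simp: in_segment A1_def P1_def)
qed

lemma open_segment_P0_P1:
  assumes a: "0 < a" "a < 1"
  shows "open_segment (P0 a) (P1 a) = {(a, y) | y. 0 < y \<and> y < 1 - a\<^sup>2}"
proof -
  define b where "b = 1 - a\<^sup>2"
  have b: "0 < b"
    using a by (simp add: b_def abs_square_less_1)
  show ?thesis
  proof (intro set_eqI iffI)
    fix p assume "p \<in> open_segment (P0 a) (P1 a)"
    then obtain t where t: "0 < t" "t < 1" "p = (1 - t) *\<^sub>R (a, b) + t *\<^sub>R (a, 0)"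
      by (auto simp: in_segment P0_def P1_def b_def)
    then have "p = (a, (1 - t) * b)" "0 < (1 - t) * b" "(1 - t) * b < 1 * b"
      using b by (simp_all add: algebra_simps)
    then show "p \<in> {(a, y) | y. 0 < y \<and> y < 1 - a\<^sup>2}"
      unfolding b_def by auto
  next
    fix p assume "p \<in> {(a, y) | y. 0 < y \<and> y < 1 - a\<^sup>2}"
    then obtain y where y: "p = (a, y)" "0 < y" "y < b"
      by (auto simp: b_def)
    then have "0 < 1 - y / b" "1 - y / b < 1" "p = (1 - (1 - y / b)) *\<^sub>R P0 a + (1 - y / b) *\<^sub>R P1 a"
      using b by (simp_all add: P0_def P1_def algebra_simps flip: b_def)
    moreover have "P0 a \<noteq> P1 a"
      using b by (simp add: P0_def P1_def b_def)
    ultimately show "p \<in> open_segment (P0 a) (P1 a)"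
      unfolding in_segment by blast
  qed
qed

lemma open_segment_A0_P0:
  assumes a: "0 < a"
  shows "open_segment A0 (P0 a) = {(x, 1 - a * x) | x. 0 < x \<and> x < a}"
proof (intro set_eqI iffI)
  fix p assume "p \<in> open_segment A0 (P0 a)"
  then obtain t where t: "0 < t" "t < 1" "p = (1 - t) *\<^sub>R (0, 1) + t *\<^sub>R (a, 1 - a\<^sup>2)"
    by (auto simp: in_segment P0_def A0_def)
  then have "p = (t * a, 1 - a * (t * a))" "0 < t * a" "t * a < 1 * a"
    using a by (simp_all add: algebra_simps power2_eq_square)
  then show "p \<in> {(x, 1 - a * x) | x. 0 < x \<and> x < a}"
    by auto
next
  fix p assume "p \<in> {(x, 1 - a * x) | x. 0 < x \<and> x < a}"
  then obtain x where x: "p = (x, 1 - a * x)" "0 < x" "x < a"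
    by auto
  then have "0 < x / a" "x / a < 1" "p = (1 - x / a) *\<^sub>R A0 + (x / a) *\<^sub>R P0 a"
    using a by (simp_all add: A0_def P0_def algebra_simps power2_eq_square)
  moreover have "A0 \<noteq> P0 a"
    using a by (simp add: A0_def P0_def)
  ultimately show "p \<in> open_segment A0 (P0 a)"
    unfolding in_segment by blast
qed

text \<open>The horocycle through \<open>P0\<close>, that is \<open>s = 1 - 2 a\<^sup>2\<close>, is tangent to the line \<open>P0 P1\<close> there, so this
value is the threshold. A smaller \<open>s\<close> puts \<open>P0\<close> inside the horodisc, together with nearby points of
the side.\<close>

lemma horodisc_misses_P0_P1_iff:
  assumes a: "0 < a" "a < 1" and s: "0 \<le> s" "s < 1"
  shows "frustum_horodisc s \<inter> open_segment (P0 a) (P1 a) = {} \<longleftrightarrow> 1 - 2 * a\<^sup>2 \<le> s"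
proof
  define b where "b = 1 - a\<^sup>2"
  have b: "0 < b" "a\<^sup>2 = 1 - b"
    using a by (simp_all add: b_def abs_square_less_1)
  {
    assume empty: "frustum_horodisc s \<inter> open_segment (P0 a) (P1 a) = {}"
    show "1 - 2 * a\<^sup>2 \<le> s"
    proof (rule ccontr)
      assume "\<not> 1 - 2 * a\<^sup>2 \<le> s"
      then have less: "s < 2 * b - 1"
        by (simp add: b_def)
      \<comment> \<open>The horodisc is where \<open>h \<ge> 0\<close>; continuity carries \<open>h > 0\<close> from \<open>P0\<close> into the open side.\<close>
      define h where "h = (\<lambda>y. (1 - s) * (1 - (a\<^sup>2 + y\<^sup>2)) - (1 - y)\<^sup>2 * (1 + s))"
      have "h b = (1 - b) * (2 * b - 1 - s)"
        unfolding h_def b(2) by (simp add: power2_eq_square algebra_simps)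
      moreover have "0 < 1 - b"
        using a b(2) by (metis zero_less_power)
      ultimately have hb: "0 < h b"
        using less by simp
      have "(h \<longlongrightarrow> h b) (at_left b)"
        unfolding h_def by (intro tendsto_intros)
      from order_tendstoD(1)[OF this hb] have "\<forall>\<^sub>F y in at_left b. 0 < h y" .
      moreover have "\<forall>\<^sub>F y in at_left b. y \<in> {0<..<b}"
        using b(1) by (rule eventually_at_left_real)
      ultimately have "\<forall>\<^sub>F y in at_left b. 0 < h y \<and> 0 < y \<and> y < b"
        by eventually_elim auto
      then obtain y where y: "0 < h y" "0 < y" "y < b"
        using eventually_happens'[OF trivial_limit_at_left_real] by blast
      have "0 \<le> (1 - y)\<^sup>2 * (1 + s)"
        using s by simp
      then have "0 < (1 - s) * (1 - (a\<^sup>2 + y\<^sup>2))"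
        using y(1) unfolding h_def by linarith
      then have "a\<^sup>2 + y\<^sup>2 < 1"
        using s by (simp add: zero_less_mult_iff)
      then have "(a, y) \<in> frustum_horodisc s"
        using y(1) by (simp add: mem_frustum_horodisc_sq_iff[OF s] h_def)
      moreover have "(a, y) \<in> open_segment (P0 a) (P1 a)"
        unfolding open_segment_P0_P1[OF a] using y by (simp add: b_def)
      ultimately show False
        using empty by blast
    qed
  }
  {
    assume le: "1 - 2 * a\<^sup>2 \<le> s"
    have "(a, y) \<notin> frustum_horodisc s" if y: "y < b" for y
    proof
      assume "(a, y) \<in> frustum_horodisc s"
      then have m: "(1 - y)\<^sup>2 * (1 + s) \<le> (1 - s) * (b - y\<^sup>2)" and "0 < b - y\<^sup>2"
        by (auto simp: mem_frustum_horodisc_sq_iff[OF s] b_def algebra_simps)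
      have "2 * b \<le> 1 + s" "1 - s \<le> 2 * (1 - b)"
        using le b(2) by simp_all
      have "(1 - y)\<^sup>2 * (2 * b) \<le> (1 - y)\<^sup>2 * (1 + s)"
        by (intro mult_left_mono) (use \<open>2 * b \<le> 1 + s\<close> in auto)
      also have "\<dots> \<le> (1 - s) * (b - y\<^sup>2)"
        by (rule m)
      also have "\<dots> \<le> 2 * (1 - b) * (b - y\<^sup>2)"
        by (intro mult_right_mono) (use \<open>1 - s \<le> 2 * (1 - b)\<close> \<open>0 < b - y\<^sup>2\<close> in auto)
      finally have "2 * (b - y)\<^sup>2 \<le> 0"
        by (simp add: power2_eq_square algebra_simps)
      moreover have "0 < (b - y)\<^sup>2"
        using y by simp
      ultimately show False
        by linarith
    qed
    then show "frustum_horodisc s \<inter> open_segment (P0 a) (P1 a) = {}"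
      unfolding open_segment_P0_P1[OF a] b_def by auto
  }
qed

lemma hypercycle_misses_A0_P0_iff:
  assumes a: "0 < a" "a < 1" and s: "0 \<le> s" "s < 1"
  shows "hypercycle_domain a s \<inter> open_segment A0 (P0 a) = {} \<longleftrightarrow> s\<^sup>2 \<le> 1 - a\<^sup>2"
proof
  have mem: "(x, y) \<in> hypercycle_domain a s \<longleftrightarrow> x\<^sup>2 + y\<^sup>2 < 1 \<and> 0 \<le> y \<and> y\<^sup>2 \<le> s\<^sup>2 * (1 - x\<^sup>2)" for x y
    using a s by (intro mem_hypercycle_domain_iff) auto
  have a2: "0 < 1 - a\<^sup>2"
    using a by (simp add: abs_square_less_1)
  have x2: "x\<^sup>2 < 1" if "0 < x" "x < a" for x
    using a that by (simp add: abs_square_less_1)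
  {
    assume empty: "hypercycle_domain a s \<inter> open_segment A0 (P0 a) = {}"
    show "s\<^sup>2 \<le> 1 - a\<^sup>2"
    proof (rule ccontr)
      assume "\<not> s\<^sup>2 \<le> 1 - a\<^sup>2"
      then have less: "1 - a\<^sup>2 < s\<^sup>2"
        by simp
      \<comment> \<open>The hypercycle domain is where \<open>h \<ge> 0\<close>; continuity carries \<open>h > 0\<close> from \<open>P0\<close> into the side.\<close>
      define h where "h = (\<lambda>x. s\<^sup>2 * (1 - x\<^sup>2) - (1 - a * x)\<^sup>2)"
      have "h a = (1 - a\<^sup>2) * (s\<^sup>2 - (1 - a\<^sup>2))"
        by (simp add: h_def power2_eq_square algebra_simps)
      then have ha: "0 < h a"
        using a2 less by simp
      have "(h \<longlongrightarrow> h a) (at_left a)"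
        unfolding h_def by (intro tendsto_intros)
      from order_tendstoD(1)[OF this ha] have "\<forall>\<^sub>F x in at_left a. 0 < h x" .
      moreover have "\<forall>\<^sub>F x in at_left a. x \<in> {0<..<a}"
        using a(1) by (rule eventually_at_left_real)
      ultimately have "\<forall>\<^sub>F x in at_left a. 0 < h x \<and> 0 < x \<and> x < a"
        by eventually_elim auto
      then obtain x where x: "0 < h x" "0 < x" "x < a"
        using eventually_happens'[OF trivial_limit_at_left_real] by blast
      have s2: "s\<^sup>2 < 1"
        using s by (simp add: abs_square_less_1)
      have "s\<^sup>2 * (1 - x\<^sup>2) \<le> 1 * (1 - x\<^sup>2)"
        using s2 x2[OF x(2,3)] by (intro mult_right_mono) auto
      moreover have "(1 - a * x)\<^sup>2 < s\<^sup>2 * (1 - x\<^sup>2)"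
        using x(1) by (simp add: h_def)
      ultimately have "(1 - a * x)\<^sup>2 < 1 - x\<^sup>2"
        by simp
      then have disc: "x\<^sup>2 + (1 - a * x)\<^sup>2 < 1"
        by (simp only: less_diff_eq add.commute)
      have "a * x < 1 * 1"
        using a x by (intro mult_strict_mono') auto
      then have "(x, 1 - a * x) \<in> hypercycle_domain a s"
        unfolding mem using disc x(1) by (simp add: h_def)
      moreover have "(x, 1 - a * x) \<in> open_segment A0 (P0 a)"
        unfolding open_segment_A0_P0[OF a(1)] using x by auto
      ultimately show False
        using empty by blast
    qed
  }
  {
    assume le: "s\<^sup>2 \<le> 1 - a\<^sup>2"
    have "(x, 1 - a * x) \<notin> hypercycle_domain a s" if x: "0 < x" "x < a" for x
    proof -
      have "s\<^sup>2 * (1 - x\<^sup>2) \<le> (1 - a\<^sup>2) * (1 - x\<^sup>2)"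
        using le x2[OF x] by (intro mult_right_mono) auto
      also have "\<dots> < (1 - a * x)\<^sup>2"
        by (rule top_side_above_hypercycle(1)) (use a x in auto)
      finally show ?thesis
        unfolding mem by simp
    qed
    then show "hypercycle_domain a s \<inter> open_segment A0 (P0 a) = {}"
      unfolding open_segment_A0_P0[OF a(1)] by auto
  }
qed

text \<open>For fixed \<open>y / \<surd>(1 - x\<^sup>2)\<close>, that is along a hypercycle, the Busemann function of \<open>A0\<close> is smallest on
the axis \<open>x = 0\<close>; so a horodisc and a hypercycle domain that are separated on the axis can meet at
most there.\<close>

lemma horodisc_hypercycle_meet_on_axis:
  assumes "a \<noteq> 0" and s: "0 \<le> s2" "s2 \<le> s1" "s1 < 1"
    and "(x, y) \<in> frustum_horodisc s1" "(x, y) \<in> hypercycle_domain a s2"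
  shows "x = 0"
proof (rule ccontr)
  assume "x \<noteq> 0"
  define w where "w = sqrt (1 - x\<^sup>2)"
  have horo: "x\<^sup>2 + y\<^sup>2 < 1" "(1 - y)\<^sup>2 * (1 + s1) \<le> (1 - s1) * (1 - (x\<^sup>2 + y\<^sup>2))"
    using assms(5) s by (simp_all add: mem_frustum_horodisc_sq_iff)
  have hyper: "0 \<le> y" "y\<^sup>2 \<le> s2\<^sup>2 * (1 - x\<^sup>2)"
    using assms(1,6) s by (simp_all add: mem_hypercycle_domain_iff)
  have "x\<^sup>2 < 1"
    using horo(1) by (smt (verit) zero_le_power2)
  moreover have "0 < x\<^sup>2"
    using \<open>x \<noteq> 0\<close> by simp
  ultimately have w: "0 < w" "w < 1" "w\<^sup>2 = 1 - x\<^sup>2"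
    by (simp_all add: w_def)
  have "y\<^sup>2 \<le> (s2 * w)\<^sup>2"
    using hyper(2) by (simp add: power_mult_distrib w(3))
  then have "y \<le> s2 * w"
    by (rule power2_le_imp_le) (use s w in auto)
  also have "\<dots> \<le> s1 * w"
    using s w by simp
  finally have y: "y \<le> s1 * w" .
  have "s1 * w < 1 * w"
    using s w by (intro mult_strict_right_mono) auto
  then have "0 < w - y"
    using y by simp
  have "(w - y)\<^sup>2 < (1 - y)\<^sup>2"
    using \<open>0 < w - y\<close> w(2) by (intro power_strict_mono) auto
  then have "(w - y)\<^sup>2 * (1 + s1) < (1 - y)\<^sup>2 * (1 + s1)"
    using s by (intro mult_strict_right_mono) auto
  also have "\<dots> \<le> (1 - s1) * (1 - (x\<^sup>2 + y\<^sup>2))"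
    by (rule horo(2))
  also have "1 - (x\<^sup>2 + y\<^sup>2) = (w - y) * (w + y)"
    using w(3) by (simp add: power2_eq_square algebra_simps)
  finally have "(w - y) * ((w - y) * (1 + s1)) < (w - y) * ((1 - s1) * (w + y))"
    by (simp add: power2_eq_square mult_ac)
  then have "(w - y) * (1 + s1) < (1 - s1) * (w + y)"
    using \<open>0 < w - y\<close> by simp
  then show False
    using y by (simp add: algebra_simps)
qed

text \<open>On the axis the horodisc is the part above \<open>s1\<close> and the hypercycle domain the part below \<open>s2\<close>. If they
overlap, the midpoint of the overlap is interior to both; otherwise they meet at most in the axis, which
has empty interior.\<close>

lemma interiors_disjoint_iff:
  assumes a: "a \<noteq> 0" and s1: "0 \<le> s1" "s1 < 1" and s2: "0 \<le> s2" "s2 < 1"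
  shows "interior (frustum_horodisc s1) \<inter> interior (hypercycle_domain a s2) = {} \<longleftrightarrow> s2 \<le> s1"
proof
  assume disj: "interior (frustum_horodisc s1) \<inter> interior (hypercycle_domain a s2) = {}"
  show "s2 \<le> s1"
  proof (rule ccontr)
    assume "\<not> s2 \<le> s1"
    define y where "y = (s1 + s2) / 2"
    have y: "s1 < y" "y < s2"
      using \<open>\<not> s2 \<le> s1\<close> by (simp_all add: y_def)
    let ?U = "{p :: point. (fst p)\<^sup>2 + (snd p)\<^sup>2 < 1} \<inter>
      {p. (1 - snd p)\<^sup>2 * (1 + s1) < (1 - s1) * (1 - ((fst p)\<^sup>2 + (snd p)\<^sup>2))} \<inter>
      {p. 0 < snd p} \<inter> {p. (snd p)\<^sup>2 < s2\<^sup>2 * (1 - (fst p)\<^sup>2)}"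
    have "open ?U"
      by (intro open_Int open_Collect_less continuous_intros)
    moreover have "?U \<subseteq> frustum_horodisc s1"
      using s1 by (auto simp: mem_frustum_horodisc_sq_iff)
    moreover have "?U \<subseteq> hypercycle_domain a s2"
      using a s2 by (auto simp: mem_hypercycle_domain_iff)
    moreover have "(0, y) \<in> ?U"
    proof -
      have "y\<^sup>2 < s2\<^sup>2" "y\<^sup>2 < 1"
        using y s1 s2 by (auto intro: power_strict_mono simp: abs_square_less_1)
      moreover have "(1 - y) * ((1 - y) * (1 + s1)) < (1 - y) * ((1 - s1) * (1 + y))"
        using y s2 by (intro mult_strict_left_mono) (auto simp: algebra_simps)
      ultimately show ?thesis
        using y s1 by (simp add: power2_eq_square algebra_simps)
    qed
    ultimately have "(0, y) \<in> interior (frustum_horodisc s1) \<inter> interior (hypercycle_domain a s2)"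
      by (meson IntI interiorI)
    then show False
      using disj by blast
  qed
next
  assume le: "s2 \<le> s1"
  have "frustum_horodisc s1 \<inter> hypercycle_domain a s2 \<subseteq> {0} \<times> UNIV"
    using horodisc_hypercycle_meet_on_axis[OF a s2(1) le s1(2)] by auto
  then have "interior (frustum_horodisc s1 \<inter> hypercycle_domain a s2) \<subseteq> interior ({0} \<times> UNIV)"
    by (rule interior_mono)
  then show "interior (frustum_horodisc s1) \<inter> interior (hypercycle_domain a s2) = {}"
    by (simp add: interior_Int interior_Times)
qed

lemma hyp_hor_packings_iff:
  "(a, s1, s2) \<in> hyp_hor_packings \<longleftrightarrow>
     0 < a \<and> a < 1 \<and> 0 \<le> s2 \<and> s2 \<le> s1 \<and> s1 < 1 \<and> 1 - 2 * a\<^sup>2 \<le> s1 \<and> s2\<^sup>2 \<le> 1 - a\<^sup>2"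
  unfolding hyp_hor_packings_def
  using horodisc_misses_base_side[of a s1] horodisc_misses_P0_P1_iff[of a s1]
    hypercycle_misses_A0_P0_iff[of a s2] interiors_disjoint_iff[of a s1 s2]
  by (auto simp: Int_commute)

section \<open>The density and its upper bound\<close>

text \<open>Two sides of the frustum do not cut the horodisc: it lies above the base line, since \<open>horo_size s \<le> 1\<close>,
and to the left of the line \<open>P0 P1\<close>, since \<open>1 - 2 a\<^sup>2 \<le> s\<close>. What remains is the sector between the two
sides that end in \<open>A0\<close>.\<close>

lemma frustum_Int_horodisc:
  assumes a: "0 < a" "a < 1" and s: "0 \<le> s" "s < 1" "1 - 2 * a\<^sup>2 \<le> s"
  shows "frustum a \<inter> frustum_horodisc s =
    {(x, y). 0 \<le> x \<and> a * x \<le> 1 - y \<and> x\<^sup>2 + y\<^sup>2 < 1 \<and>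
             1 - y \<le> horo_size s * sqrt (1 - (x\<^sup>2 + y\<^sup>2))}"
proof -
  have inside: "x \<le> a \<and> 0 \<le> y" if m: "(x, y) \<in> frustum_horodisc s" for x y
  proof
    have disc: "x\<^sup>2 + y\<^sup>2 < 1" and sq: "(1 - y)\<^sup>2 * (1 + s) \<le> (1 - s) * (1 - (x\<^sup>2 + y\<^sup>2))"
      using m by (auto simp: mem_frustum_horodisc_sq_iff[OF s(1,2)])
    have "(1 - y)\<^sup>2 * (2 * (1 - a\<^sup>2)) \<le> (1 - y)\<^sup>2 * (1 + s)"
      using s(3) by (intro mult_left_mono) auto
    also note sq
    also have "(1 - s) * (1 - (x\<^sup>2 + y\<^sup>2)) \<le> (2 * a\<^sup>2) * (1 - (x\<^sup>2 + y\<^sup>2))"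
      using s(3) disc by (intro mult_right_mono) auto
    finally have "0 \<le> (2 * a\<^sup>2) * (1 - (x\<^sup>2 + y\<^sup>2)) - (1 - y)\<^sup>2 * (2 * (1 - a\<^sup>2))"
      by (simp only: diff_ge_0_iff_ge)
    \<comment> \<open>Completing the square in \<open>y\<close>, centred at the height \<open>1 - a\<^sup>2\<close> of \<open>P0\<close>.\<close>
    also have "\<dots> = 2 * (a\<^sup>2 * (a\<^sup>2 - x\<^sup>2) - (y - (1 - a\<^sup>2))\<^sup>2)"
      by (simp add: power2_eq_square algebra_simps)
    finally have "0 \<le> a\<^sup>2 * (a\<^sup>2 - x\<^sup>2) - (y - (1 - a\<^sup>2))\<^sup>2"
      by (simp only: zero_le_mult_iff) simp
    then have "(y - (1 - a\<^sup>2))\<^sup>2 \<le> a\<^sup>2 * (a\<^sup>2 - x\<^sup>2)"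
      by simp
    then have "0 \<le> a\<^sup>2 * (a\<^sup>2 - x\<^sup>2)"
      by (rule order_trans[OF zero_le_power2])
    then have "x\<^sup>2 \<le> a\<^sup>2"
      using a by (simp add: zero_le_mult_iff)
    then show "x \<le> a"
      by (rule power2_le_imp_le) (use a in simp)
    have "1 - y \<le> horo_size s * sqrt (1 - (x\<^sup>2 + y\<^sup>2))"
      using m by (simp add: mem_frustum_horodisc_horo_size_iff[OF s(1,2)])
    also have "\<dots> \<le> 1 * 1"
      using disc horo_size_le_1[OF s(1,2)] by (intro mult_mono) auto
    finally show "0 \<le> y"
      by simp
  qed
  show ?thesis
  proof (intro set_eqI)
    fix p :: point
    obtain x y where p: "p = (x, y)"
      by (cases p)
    have "y \<le> 1 - a * x \<longleftrightarrow> a * x \<le> 1 - y"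
      by linarith
    then show "p \<in> frustum a \<inter> frustum_horodisc s \<longleftrightarrow> p \<in> {(x, y). 0 \<le> x \<and> a * x \<le> 1 - y \<and>
        x\<^sup>2 + y\<^sup>2 < 1 \<and> 1 - y \<le> horo_size s * sqrt (1 - (x\<^sup>2 + y\<^sup>2))}"
      using inside[of x y] mem_frustum_horodisc_horo_size_iff[OF s(1,2), of x y]
      unfolding p frustum_eq[OF a] Int_iff mem_Collect_eq prod.case by blast
  qed
qed

text \<open>The side \<open>A0 P0\<close> does not cut the hypercycle domain below it, so the intersection is the region under
the hypercycle.\<close>

lemma frustum_Int_hypercycle_domain:
  assumes a: "0 < a" "a < 1" and s: "0 \<le> s" "s < 1" "s\<^sup>2 \<le> 1 - a\<^sup>2"
  shows "frustum a \<inter> hypercycle_domain a s =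
    {(x, y). 0 \<le> x \<and> x \<le> a \<and> 0 \<le> y \<and> y \<le> s * sqrt (1 - x\<^sup>2)}"
proof -
  have iff: "(x, y) \<in> hypercycle_domain a s \<and> y \<le> 1 - a * x \<longleftrightarrow> y \<le> s * sqrt (1 - x\<^sup>2)"
    if x: "0 \<le> x" "x \<le> a" and y: "0 \<le> y" for x y
  proof -
    have x2: "x\<^sup>2 < 1"
      using a x by (simp add: abs_square_less_1)
    have "0 \<le> s * sqrt (1 - x\<^sup>2)"
      using s(1) x2 by simp
    then have "y \<le> s * sqrt (1 - x\<^sup>2) \<longleftrightarrow> y\<^sup>2 \<le> (s * sqrt (1 - x\<^sup>2))\<^sup>2"
      by (intro power_mono_iff[symmetric] y) simp_all
    also have "(s * sqrt (1 - x\<^sup>2))\<^sup>2 = s\<^sup>2 * (1 - x\<^sup>2)"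
      using x2 by (simp add: power_mult_distrib)
    finally have sq: "y \<le> s * sqrt (1 - x\<^sup>2) \<longleftrightarrow> y\<^sup>2 \<le> s\<^sup>2 * (1 - x\<^sup>2)" .
    have "x\<^sup>2 + y\<^sup>2 < 1 \<and> y \<le> 1 - a * x" if le: "y\<^sup>2 \<le> s\<^sup>2 * (1 - x\<^sup>2)"
    proof
      have "s\<^sup>2 < 1"
        using s(1,2) by (simp add: abs_square_less_1)
      then have "s\<^sup>2 * (1 - x\<^sup>2) < 1 * (1 - x\<^sup>2)"
        using x2 by (intro mult_strict_right_mono) simp_all
      with le have "y\<^sup>2 < 1 * (1 - x\<^sup>2)"
        by (rule le_less_trans)
      then have "y\<^sup>2 < 1 - x\<^sup>2"
        by (simp only: mult_1)
      then show "x\<^sup>2 + y\<^sup>2 < 1"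
        by (simp only: less_diff_eq add.commute)
      note le
      also have "s\<^sup>2 * (1 - x\<^sup>2) \<le> (1 - a\<^sup>2) * (1 - x\<^sup>2)"
        using s(3) by (rule mult_right_mono) (use x2 in simp)
      also have "(1 - a\<^sup>2) * (1 - x\<^sup>2) = (1 - a * x)\<^sup>2 - (a - x)\<^sup>2"
        by (simp add: power2_eq_square algebra_simps)
      also have "\<dots> \<le> (1 - a * x)\<^sup>2"
        by simp
      finally have "y\<^sup>2 \<le> (1 - a * x)\<^sup>2" .
      moreover have "a * x \<le> 1 * 1"
        using a x by (intro mult_mono) auto
      then have "0 \<le> 1 - a * x"
        by simp
      ultimately show "y \<le> 1 - a * x"
        by (rule power2_le_imp_le)
    qed
    then show ?thesis
      unfolding sq mem_hypercycle_domain_iff[OF less_imp_neq[OF a(1), symmetric] s(1,2)]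
      using y by blast
  qed
  show ?thesis
  proof (intro set_eqI)
    fix p :: point
    obtain x y where p: "p = (x, y)"
      by (cases p)
    show "p \<in> frustum a \<inter> hypercycle_domain a s \<longleftrightarrow>
        p \<in> {(x, y). 0 \<le> x \<and> x \<le> a \<and> 0 \<le> y \<and> y \<le> s * sqrt (1 - x\<^sup>2)}"
      using iff[of x y] unfolding p frustum_eq[OF a] Int_iff mem_Collect_eq prod.case by blast
  qed
qed

lemma null_sets_harea_axis: "{0} \<times> UNIV \<in> null_sets harea_measure"
proof -
  have "closed ({0} \<times> UNIV :: point set)"
    by (intro closed_Times) auto
  then have S: "({0} \<times> UNIV :: point set) \<in> sets borel"
    by (rule borel_closed)
  have "emeasure harea_measure ({0} \<times> UNIV) =
      (\<integral>\<^sup>+x. (\<integral>\<^sup>+y. ennreal (klein_density x y) * indicator ({0} \<times> UNIV) (x, y) \<partial>lborel) \<partial>lborel)"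
    by (rule emeasure_harea_measure(1)[OF S])
  also have "\<dots> = (\<integral>\<^sup>+x. 0 \<partial>(lborel :: real measure))"
    by (intro nn_integral_cong_AE, use AE_lborel_singleton[of 0] in eventually_elim) simp
  finally show ?thesis
    using S by (simp add: null_sets_def)
qed

text \<open>Horodisc and hypercycle domain overlap at most in the axis, so their areas in the frustum add up.\<close>

lemma packing_density_eq:
  assumes "(a, s1, s2) \<in> hyp_hor_packings"
  shows "packing_density (a, s1, s2)
           = (horo_size s1 / a + s2 / sqrt (1 - s2\<^sup>2) * artanh a) / (pi / 2)"
proof -
  have a: "0 < a" "a < 1" and s: "0 \<le> s2" "s2 \<le> s1" "s1 < 1"
    and adm: "1 - 2 * a\<^sup>2 \<le> s1" "s2\<^sup>2 \<le> 1 - a\<^sup>2"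
    using assms by (simp_all add: hyp_hor_packings_iff)
  have s1: "0 \<le> s1" and s2: "s2 < 1"
    using s by simp_all
  let ?H = "frustum a \<inter> frustum_horodisc s1"
  let ?K = "frustum a \<inter> hypercycle_domain a s2"
  note H_eq = frustum_Int_horodisc[OF a s1 s(3) adm(1)]
  note K_eq = frustum_Int_hypercycle_domain[OF a s(1) s2 adm(2)]
  have H_sets: "?H \<in> sets borel"
    unfolding H_eq case_prod_beta by measurable
  have K_sets: "?K \<in> sets borel"
    unfolding K_eq case_prod_beta by measurable
  have H: "emeasure harea_measure ?H = ennreal (horo_size s1 / a)"
    using H_sets unfolding H_eq
    by (intro emeasure_harea_horodisc_sector a horo_size_pos[OF s1 s(3)])
  have K: "emeasure harea_measure ?K = ennreal (s2 / sqrt (1 - s2\<^sup>2) * artanh a)"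
    unfolding K_eq by (rule emeasure_harea_hypercycle_strip[OF a s(1) s2])
  have K_nonneg: "0 \<le> s2 / sqrt (1 - s2\<^sup>2) * artanh a"
  proof -
    have "0 \<le> artanh a"
      unfolding artanh_def using a by simp
    moreover have "s2\<^sup>2 < 1"
      using s(1) s2 by (simp add: abs_square_less_1)
    ultimately show ?thesis
      using s(1) by simp
  qed
  have H_fin: "?H \<in> fmeasurable harea_measure"
    by (rule fmeasurableI)
      (simp only: sets_harea_measure H_sets, simp only: H ennreal_less_top infinity_ennreal_def)
  have K_fin: "?K \<in> fmeasurable harea_measure"
    by (rule fmeasurableI)
      (simp only: sets_harea_measure K_sets, simp only: K ennreal_less_top infinity_ennreal_def)
  have "?H \<inter> ?K \<subseteq> {0} \<times> UNIV"
    using horodisc_hypercycle_meet_on_axis[OF less_imp_neq[OF a(1), symmetric] s] by auto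
  then have "?H \<inter> ?K \<in> null_sets harea_measure"
    by (intro null_sets_subset[OF null_sets_harea_axis])
      (simp only: sets_harea_measure sets.Int[OF H_sets K_sets])
  then have overlap: "measure harea_measure (?H \<inter> ?K) = 0"
    by (simp add: measure_def null_setsD1)
  have "harea (frustum a \<inter> (frustum_horodisc s1 \<union> hypercycle_domain a s2))
      = measure harea_measure (?H \<union> ?K)"
    by (simp add: harea_def Int_Un_distrib)
  also have "\<dots> = measure harea_measure ?H + measure harea_measure ?K"
    unfolding measure_Un3[OF H_fin K_fin] overlap by (rule diff_zero)
  also have "measure harea_measure ?H = horo_size s1 / a"
    using H by (rule measure_eq_emeasure_eq_ennreal[rotated])
      (use a(1) horo_size_pos[OF s1 s(3)] in simp)
  also have "measure harea_measure ?K = s2 / sqrt (1 - s2\<^sup>2) * artanh a"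
    by (rule measure_eq_emeasure_eq_ennreal[OF K_nonneg K])
  finally have "harea (frustum a \<inter> (frustum_horodisc s1 \<union> hypercycle_domain a s2))
      = horo_size s1 / a + s2 / sqrt (1 - s2\<^sup>2) * artanh a" .
  moreover have "harea (frustum a) = pi / 2"
    by (simp add: harea_def measure_def emeasure_harea_frustum[OF a])
  ultimately show ?thesis
    by (simp only: packing_density_def prod.case)
qed

text \<open>The covered area grows when the horodisc and the hypercycle domain are enlarged. Both can be enlarged
until they touch at the common height \<open>min s1 (\<surd>(1 - a\<^sup>2))\<close> without violating the constraints of the
frustum, and touching configurations are covered by the convexity argument.\<close>

lemma packing_density_le:
  assumes "P \<in> hyp_hor_packings"
  shows "packing_density P \<le> 3 / pi"
proof -
  obtain a s1 s2 where P: "P = (a, s1, s2)"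
    by (cases P) auto
  have a: "0 < a" "a < 1" and s: "0 \<le> s2" "s2 \<le> s1" "s1 < 1"
    and adm: "1 - 2 * a\<^sup>2 \<le> s1" "s2\<^sup>2 \<le> 1 - a\<^sup>2"
    using assms by (simp_all add: P hyp_hor_packings_iff)
  define c where "c = sqrt (1 - a\<^sup>2)"
  define s where "s = min s1 c"
  have a2: "0 < a\<^sup>2" "a\<^sup>2 < 1"
    using a by (simp_all add: abs_square_less_1)
  have c: "0 < c" "c < 1" "c\<^sup>2 = 1 - a\<^sup>2"
    using a2 by (simp_all add: c_def)
  have "s2 \<le> c"
    by (rule power2_le_imp_le) (use adm c in auto)
  then have s_bounds: "s2 \<le> s" "s \<le> s1" "s \<le> c" "0 \<le> s" "s < 1"
    using s c by (auto simp: s_def)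
  have "c\<^sup>2 \<le> c"
    using c(1,2) by (simp add: power2_eq_square mult_left_le)
  then have s_lower: "1 - 2 * a\<^sup>2 \<le> s"
    using adm(1) a2(1) c(3) unfolding s_def by linarith
  define k where "k = horo_size s"
  have "horo_size c \<le> k"
    unfolding k_def by (rule horo_size_antimono) (use s_bounds c in auto)
  then have "(1 - sqrt (1 - a\<^sup>2)) / a \<le> k"
    by (simp only: c_def horo_size_sqrt[OF a])
  moreover have "k \<le> 1"
    unfolding k_def by (rule horo_size_le_1) (use s_bounds in auto)
  moreover have "k\<^sup>2 * (1 - a\<^sup>2) \<le> a\<^sup>2"
  proof -
    have "(1 - s) * (1 - a\<^sup>2) \<le> a\<^sup>2 * (1 + s)"
      using s_lower by (simp add: algebra_simps)
    then show ?thesis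
      using s_bounds by (simp add: k_def horo_size_sq pos_divide_le_eq)
  qed
  ultimately have main: "k / a + (1 / k - k) / 2 * artanh a \<le> 3 / 2"
    by (intro contact_area_le a)
  have "horo_size s1 / a \<le> k / a"
    unfolding k_def using a s s_bounds by (intro divide_right_mono horo_size_antimono) auto
  moreover have "s2 / sqrt (1 - s2\<^sup>2) * artanh a \<le> (1 / k - k) / 2 * artanh a"
  proof (rule mult_right_mono)
    show "s2 / sqrt (1 - s2\<^sup>2) \<le> (1 / k - k) / 2"
      unfolding k_def sinh_artanh_eq_horo_size[OF s_bounds(4,5), symmetric]
      using s s_bounds by (intro sinh_artanh_mono) auto
    show "0 \<le> artanh a"
      unfolding artanh_def using a by simp
  qed
  ultimately have "horo_size s1 / a + s2 / sqrt (1 - s2\<^sup>2) * artanh a \<le> 3 / 2"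
    using main by linarith
  then have "packing_density P \<le> (3 / 2) / (pi / 2)"
    unfolding P packing_density_eq[OF assms[unfolded P]] by (intro divide_right_mono) auto
  then show ?thesis
    by simp
qed

section \<open>The limits of types 1 and 2\<close>

lemma type1_admissible:
  assumes a: "0 < a" "a < 1"
  shows "type1 a \<in> hyp_hor_packings"
proof -
  have a2: "0 < a\<^sup>2" "a\<^sup>2 < 1"
    using a by (simp_all add: abs_square_less_1)
  have "1 - 2 * a\<^sup>2 \<le> sqrt (1 - a\<^sup>2)"
  proof -
    have "(1 - a\<^sup>2)\<^sup>2 \<le> 1 - a\<^sup>2"
      using a2 by (simp add: power2_eq_square mult_left_le)
    then have "1 - a\<^sup>2 \<le> sqrt (1 - a\<^sup>2)"
      by (rule real_le_rsqrt)
    then show ?thesis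
      using a2 by linarith
  qed
  then show ?thesis
    using a a2 by (simp add: type1_def hyp_hor_packings_iff)
qed

lemma type2_admissible:
  assumes a: "0 < a" "a \<le> 1 / sqrt 2"
  shows "type2 a \<in> hyp_hor_packings"
proof -
  have "a\<^sup>2 \<le> (1 / sqrt 2)\<^sup>2"
    using a by (intro power_mono) auto
  then have a2: "a\<^sup>2 \<le> 1 / 2" "0 < a\<^sup>2"
    using a by (simp_all add: power_divide)
  then have "\<bar>a\<bar> < 1"
    by (simp flip: abs_square_less_1)
  then have "a < 1"
    by simp
  have "(1 - a\<^sup>2) - (1 - 2 * a\<^sup>2)\<^sup>2 = a\<^sup>2 * (3 - 4 * a\<^sup>2)"
    by (simp add: power2_eq_square algebra_simps)
  moreover have "0 \<le> a\<^sup>2 * (3 - 4 * a\<^sup>2)"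
    using a2 by simp
  ultimately have "(1 - 2 * a\<^sup>2)\<^sup>2 \<le> 1 - a\<^sup>2"
    by linarith
  then show ?thesis
    using a a2 \<open>a < 1\<close> by (simp add: type2_def hyp_hor_packings_iff)
qed

lemma artanh_over_self_tendsto: "((\<lambda>a. artanh a / a) \<longlongrightarrow> (1::real)) (at_right 0)"
proof -
  have "(artanh has_real_derivative 1 / (1 - 0\<^sup>2)) (at 0)"
    by (rule artanh_real_has_field_derivative) simp
  then have "((\<lambda>a. artanh a / a) \<longlongrightarrow> (1::real)) (at 0)"
    by (simp add: DERIV_def)
  then show ?thesis
    by (rule tendsto_within_subset) simp
qed

lemma packing_density_type1_tendsto:
  "((\<lambda>a. packing_density (type1 a)) \<longlongrightarrow> 3 / pi) (at_right 0)"
proof (rule Lim_transform_eventually)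
  show "((\<lambda>a. (1 / (1 + sqrt (1 - a\<^sup>2)) + sqrt (1 - a\<^sup>2) * (artanh a / a)) / (pi / 2)) \<longlongrightarrow> 3 / pi) (at_right 0)"
    by (rule tendsto_eq_intros artanh_over_self_tendsto refl | simp)+
  show "\<forall>\<^sub>F a in at_right 0. (1 / (1 + sqrt (1 - a\<^sup>2)) + sqrt (1 - a\<^sup>2) * (artanh a / a)) / (pi / 2)
      = packing_density (type1 a)"
    using eventually_at_right_real[OF zero_less_one]
  proof eventually_elim
    fix a :: real assume "a \<in> {0<..<1}"
    then have a: "0 < a" "a < 1"
      by auto
    define c where "c = sqrt (1 - a\<^sup>2)"
    have "0 < a\<^sup>2" "a\<^sup>2 < 1"
      using a by (simp_all add: abs_square_less_1)
    then have c: "0 < c" "c < 1" "c\<^sup>2 = 1 - a\<^sup>2"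
      by (simp_all add: c_def)
    then have aa: "a * a = (1 - c) * (1 + c)"
      by (simp add: power2_eq_square algebra_simps)
    have "horo_size c / a = (1 - c) / (a * a)"
      by (simp add: c_def horo_size_sqrt[OF a])
    also have "\<dots> = 1 / (1 + c)"
      unfolding aa using c(1,2) by simp
    finally have "horo_size c / a = 1 / (1 + c)" .
    moreover have "sqrt (1 - c\<^sup>2) = a"
      using a \<open>a\<^sup>2 < 1\<close> by (simp add: c_def)
    moreover have "packing_density (a, c, c)
        = (horo_size c / a + c / sqrt (1 - c\<^sup>2) * artanh a) / (pi / 2)"
      by (rule packing_density_eq) (use type1_admissible[OF a] in \<open>simp only: type1_def c_def\<close>)
    ultimately show "(1 / (1 + sqrt (1 - a\<^sup>2)) + sqrt (1 - a\<^sup>2) * (artanh a / a)) / (pi / 2)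
        = packing_density (type1 a)"
      unfolding type1_def c_def[symmetric] by simp
  qed
qed

lemma packing_density_type2_tendsto:
  "((\<lambda>a. packing_density (type2 a)) \<longlongrightarrow> 3 / pi) (at_right 0)"
proof (rule Lim_transform_eventually)
  show "((\<lambda>a. (1 / sqrt (1 - a\<^sup>2) + (1 - 2 * a\<^sup>2) / (2 * sqrt (1 - a\<^sup>2)) * (artanh a / a)) / (pi / 2))
      \<longlongrightarrow> 3 / pi) (at_right 0)"
    by (rule tendsto_eq_intros artanh_over_self_tendsto refl | simp)+
  have "(0::real) < 1 / sqrt 2"
    by simp
  show "\<forall>\<^sub>F a in at_right 0.
      (1 / sqrt (1 - a\<^sup>2) + (1 - 2 * a\<^sup>2) / (2 * sqrt (1 - a\<^sup>2)) * (artanh a / a)) / (pi / 2)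
      = packing_density (type2 a)"
    using eventually_at_right_real[OF \<open>0 < 1 / sqrt 2\<close>]
  proof eventually_elim
    fix a :: real assume "a \<in> {0<..<1 / sqrt 2}"
    then have adm: "type2 a \<in> hyp_hor_packings"
      by (intro type2_admissible) auto
    then have a: "0 < a" "a < 1"
      by (simp_all add: type2_def hyp_hor_packings_iff)
    have "1 - (1 - 2 * a\<^sup>2)\<^sup>2 = (2 * a)\<^sup>2 * (1 - a\<^sup>2)"
      by (simp add: power2_eq_square algebra_simps)
    then have "sqrt (1 - (1 - 2 * a\<^sup>2)\<^sup>2) = 2 * a * sqrt (1 - a\<^sup>2)"
      using a by (simp add: real_sqrt_mult)
    then show "(1 / sqrt (1 - a\<^sup>2) + (1 - 2 * a\<^sup>2) / (2 * sqrt (1 - a\<^sup>2)) * (artanh a / a)) / (pi / 2)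
        = packing_density (type2 a)"
      using packing_density_eq[OF adm[unfolded type2_def]] a
      by (simp add: type2_def horo_size_type2 mult_ac)
  qed
qed

theorem theorem4p6:
  shows "(\<forall>a. 0 < a \<and> a < 1 \<longrightarrow> type1 a \<in> hyp_hor_packings)
    \<and> (\<forall>a. 0 < a \<and> a \<le> 1 / sqrt 2 \<longrightarrow> type2 a \<in> hyp_hor_packings)
    \<and> bdd_above (packing_density ` hyp_hor_packings)
    \<and> (SUP P\<in>hyp_hor_packings. packing_density P) = 3 / pi
    \<and> ((\<lambda>a. packing_density (type1 a)) \<longlongrightarrow> 3 / pi) (at_right 0)
    \<and> ((\<lambda>a. packing_density (type2 a)) \<longlongrightarrow> 3 / pi) (at_right 0)"
proof -
  have bdd: "bdd_above (packing_density ` hyp_hor_packings)"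
    using packing_density_le by (intro bdd_aboveI2)
  have "(SUP P\<in>hyp_hor_packings. packing_density P) = 3 / pi"
  proof (rule antisym)
    have "type1 (1 / 2) \<in> hyp_hor_packings"
      by (rule type1_admissible) simp_all
    then show "(SUP P\<in>hyp_hor_packings. packing_density P) \<le> 3 / pi"
      by (intro cSUP_least packing_density_le) auto
    have "\<forall>\<^sub>F a in at_right 0. packing_density (type1 a) \<le> (SUP P\<in>hyp_hor_packings. packing_density P)"
      using eventually_at_right_real[OF zero_less_one]
      by eventually_elim (auto intro!: cSUP_upper bdd type1_admissible)
    then show "3 / pi \<le> (SUP P\<in>hyp_hor_packings. packing_density P)"
      by (intro tendsto_upperbound[OF packing_density_type1_tendsto]) auto
  qed
  then show ?thesis
    using bdd type1_admissible type2_admissible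
      packing_density_type1_tendsto packing_density_type2_tendsto by blast
qed

end
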